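(* Let $\theta=\begin{bmatrix}\alpha&\gamma\\ \beta&\delta\end{bmatrix}\in GL_2(\mathbb{Z})$, let $G=(\mathbb{Z}\oplus\mathbb{Z})\rtimes_\theta\mathbb{Z}$, and let $A,B,C,D,E\in\mathbb{Z}G$ be the elements defined in the context. Let $P_0=\langle x\rangle$, $P_1=\langle y_1\rangle\oplus\langle y_2\rangle\oplus\langle y_3\rangle$, $P_2=\langle z_1\rangle\oplus\langle z_2\rangle\oplus\langle z_3\rangle$, $P_3=\langle w\rangle$ be free left $\mathbb{Z}G$-modules on the indicated generators (so $P_0\cong P_3\cong\mathbb{Z}G$ and $P_1\cong P_2\cong(\mathbb{Z}G)^3$). Then the sequence $$0\to P_3\xrightarrow{\partial_3}P_2\xrightarrow{\partial_2}P_1\xrightarrow{\partial_1}P_0\xrightarrow{\varepsilon_0}\mathbb{Z}\to0$$ is a free resolution of the trivial module $\mathbb{Z}$ over $\mathbb{Z}G$, where the $\mathbb{Z}G$-homomorphisms are given by $$\varepsilon_0(x)=1,$$ $$\partial_1(y_1)=[(a,1)-(1,1)]x,\quad \partial_1(y_2)=[(b,1)-(1,1)]x,\quad \partial_1(y_3)=[(1,t)-(1,1)]x,$$ $$\partial_2(z_1)=Ay_1+By_2+[(a,1)-(1,1)]y_3,$$ $$\partial_2(z_2)=Cy_1+Dy_2+[(b,1)-(1,1)]y_3,$$ $$\partial_2(z_3)=[(1,1)-(b,1)]y_1+[(a,1)-(1,1)]y_2,$$ $$\partial_3(w)=[(1,1)-(b,1)]z_1+[(a,1)-(1,1)]z_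2+Ez_3.$$
   Context: **The group.** Write $\mathbb{Z}\oplus\mathbb{Z}=\langle a,b\mid ab=ba\rangle$ and $\mathbb{Z}=\langle t\rangle$; $t$ acts on $\mathbb{Z}\oplus\mathbb{Z}$ by the automorphism $a\mapsto a^\alpha b^\beta$, $b\mapsto a^\gamma b^\delta$, also denoted $\theta$. $G=(\mathbb{Z}\oplus\mathbb{Z})\rtimes_\theta\mathbb{Z}=\{(a^mb^n,t^k):m,n,k\in\mathbb{Z}\}$ with product $(g,t^k)(h,t^l)=(g\,\theta^k(h),t^{k+l})$ and identity $(1,1)$. It is the fundamental group of the torus bundle over $S^1$ determined by $\theta$. **The integers $m_i,n_i$.** $\begin{bmatrix}m_1&m_2\\ n_1&n_2\end{bmatrix}=-\theta^{-1}=\frac{1}{\alpha\delta-\beta\gamma}\begin{bmatrix}-\delta&\gamma\\ \beta&-\alpha\end{bmatrix}$. **The elements $A,B,C,D$.** $A=(1,1)+\sum_{k=1}^{m_1}(a^{-k\alpha}b^{-k\beta},t)$ if $m_1>0$; $A=(1,1)-\sum_{k=0}^{-m_1-1}(a^{k\alpha}b^{k\beta},t)$ if $m_1<0$; $A=(1,1)$ if $m_1=0$. $B=\sum_{k=0}^{n_1-1}(a^{1+k\gamma}b^{k\delta},t)$ if $n_1>0$; $B=-\sum_{k=1}^{-n_1}(a^{1-k\gamma}b^{-k\delta},t)$ if $n_1<0$; $B=0$ if $n_1=0$. $C=\sum_{k=1}^{m_2}(a^{-k\alpha}b^{-k\beta},t)$ if $m_2>0$; $C=-\sum_{k=0}^{-m_2-1}(a^{k\alpha}b^{k\beta},t)$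 if $m_2<0$; $C=0$ if $m_2=0$. $D=(1,1)+\sum_{k=0}^{n_2-1}(a^{k\gamma}b^{1+k\delta},t)$ if $n_2>0$; $D=(1,1)-\sum_{k=1}^{-n_2}(a^{-k\gamma}b^{1-k\delta},t)$ if $n_2<0$; $D=(1,1)$ if $n_2=0$. **The element $E$.** $$E=-(1,1)+\sum_{(m,n)\in I_1\times J_1}(a^{\alpha m+\gamma n}b^{\beta m+\delta n},t)-\sum_{(m,n)\in I_2\times J_2}(a^{\alpha m+\gamma n}b^{\beta m+\delta n},t),$$ where the finite sets $I_1,J_1,I_2,J_2\subset\mathbb{Z}$ are given by the following table. Here $[p,q]$ means $\{i\in\mathbb{Z}:p\le i\le q\}$ (empty if $p>q$), and each row begins with the signs or values of $(m_1,n_1,m_2,n_2)$, where $*$ means any integer. The rows cover all cases, and where two rows apply they give the same $E$. - $(+,+,+,+)$, $m_1\le m_2$, $n_1\le n_2$: $I_1=[-m_1-m_2,-m_2-1]$, $J_1=[-n_2,-n_1-1]$, $I_2=[-m_2,-m_1-1]$, $J_2=[-n_1,-1]$. - $(+,+,+,+)$, $m_1\ge m_2$, $n_1\ge n_2$: $I_1=[-m_1,-m_2-1]$, $J_1=[-n_2,-1]$, $I_2=[-m_1-m_2,-m_1-1]$, $J_2=[-n_1,-n_2-1]$. - $(-,-,-,-)$, $m_1\ge m_2$, $n_1\ge n_2$: $I_1=[-m_2,-m_1-m_2-1]$, $J_1=[-n_1,-n_2-1]$, $I_2=[-m_1,-m_2-1]$, $J_2=[0,-n_1-1]$. - $(-,-,-,-)$,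 $m_1\le m_2$, $n_1\le n_2$: $I_1=[-m_2,-m_1-1]$, $J_1=[0,-n_2-1]$, $I_2=[-m_1,-m_1-m_2-1]$, $J_2=[-n_2,-n_1-1]$. - $(-,+,+,-)$: $I_1=[-m_2,-m_1-m_2-1]$, $J_1=[0,-n_2-1]$, $I_2=[-m_1-m_2,-m_1-1]$, $J_2=[-n_1,-1]$. - $(+,-,-,+)$: $I_1=[-m_1-m_2,-m_2-1]$, $J_1=[-n_2,-1]$, $I_2=[-m_1,-m_1-m_2-1]$, $J_2=[0,-n_1-1]$. - $(+,-,+,-)$, $m_1\le m_2$, $n_1\ge n_2$: $I_1=[-m_2,-m_1-1]$, $J_1=[0,-n_1-1]$, $I_2=[-m_1-m_2,-m_2-1]$, $J_2=[-n_1,-n_2-1]$. - $(+,-,+,-)$, $m_1\ge m_2$, $n_1\le n_2$: $I_1=[-m_1-m_2,-m_1-1]$, $J_1=[-n_2,-n_1-1]$, $I_2=[-m_1,-m_2-1]$, $J_2=[0,-n_2-1]$. - $(-,+,-,+)$, $m_1\le m_2$, $n_1\ge n_2$: $I_1=[-m_1,-m_1-m_2-1]$, $J_1=[-n_1,-n_2-1]$, $I_2=[-m_2,-m_1-1]$, $J_2=[-n_2,-1]$. - $(-,+,-,+)$, $m_1\ge m_2$, $n_1\le n_2$: $I_1=[-m_1,-m_2-1]$, $J_1=[-n_1,-1]$, $I_2=[-m_2,-m_1-m_2-1]$, $J_2=[-n_2,-n_1-1]$. - $(+,+,-,-)$: $I_1=[-m_1,-m_1-m_2-1]$, $J_1=[-n_1,-1]$,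 $I_2=[-m_1-m_2,-m_2-1]$, $J_2=[0,-n_2-1]$. - $(-,-,+,+)$: $I_1=[-m_1-m_2,-m_1-1]$, $J_1=[0,-n_1-1]$, $I_2=[-m_2,-m_1-m_2-1]$, $J_2=[-n_2,-1]$. In the remaining rows one of the products $I_i\times J_i$ is empty and only the other is listed: - $(0,1,1,* )$: $I_2=\{-1\},J_2=\{-1\}$. $(0,-1,-1,* )$: $I_2=\{0\},J_2=\{0\}$. $(0,1,-1,* )$: $I_1=\{0\},J_1=\{-1\}$. $(0,-1,1,* )$: $I_1=\{-1\},J_1=\{0\}$. - $(1,0,*,1)$: $I_1=\{-m_2-1\},J_1=\{-1\}$. $(-1,0,*,-1)$: $I_1=\{-m_2\},J_1=\{0\}$. $(1,0,*,-1)$: $I_2=\{-m_2-1\},J_2=\{0\}$. $(-1,0,*,1)$: $I_2=\{-m_2\},J_2=\{-1\}$. - $(1,*,0,1)$: $I_1=\{-1\},J_1=\{-1\}$. $(-1,*,0,-1)$: $I_1=\{0\},J_1=\{0\}$. $(1,*,0,-1)$: $I_2=\{-1\},J_2=\{0\}$. $(-1,*,0,1)$: $I_2=\{0\},J_2=\{-1\}$. - $( *,1,1,0)$: $I_2=\{-m_1-1\},J_2=\{-1\}$. $( *,-1,-1,0)$: $I_2=\{-m_1\},J_2=\{0\}$. $( *,1,-1,0)$: $I_1=\{-m_1\},J_1=\{-1\}$. $( *,-1,1,0)$: $I_1=\{-m_1-1\},J_1=\{0\}$. *)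

theory Defs
  imports "HOL-Analysis.Analysis" "HOL-Algebra.Algebra"
begin

section \<open>Left modules, free modules and free resolutions\<close>

text \<open>The locale \<^locale>\<open>module\<close> of HOL-Algebra requires a commutative ring of scalars;
  this is the same list of axioms over an arbitrary ring.\<close>

locale left_module = R?: ring R + M?: abelian_group M
  for R :: "('r, 'x) ring_scheme" (structure) and M :: "('r, 'm, 'y) module_scheme" (structure) +
  assumes smult_closed:
      "\<lbrakk>r \<in> carrier R; v \<in> carrier M\<rbrakk> \<Longrightarrow> r \<odot>\<^bsub>M\<^esub> v \<in> carrier M"
    and smult_l_distr:
      "\<lbrakk>r \<in> carrier R; s \<in> carrier R; v \<in> carrier M\<rbrakk> \<Longrightarrow>
        (r \<oplus> s) \<odot>\<^bsub>M\<^esub> v = r \<odot>\<^bsub>M\<^esub> v \<oplus>\<^bsub>M\<^esub> s \<odot>\<^bsub>M\<^esub> v"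
    and smult_r_distr:
      "\<lbrakk>r \<in> carrier R; v \<in> carrier M; u \<in> carrier M\<rbrakk> \<Longrightarrow>
        r \<odot>\<^bsub>M\<^esub> (v \<oplus>\<^bsub>M\<^esub> u) = r \<odot>\<^bsub>M\<^esub> v \<oplus>\<^bsub>M\<^esub> r \<odot>\<^bsub>M\<^esub> u"
    and smult_assoc1:
      "\<lbrakk>r \<in> carrier R; s \<in> carrier R; v \<in> carrier M\<rbrakk> \<Longrightarrow>
        (r \<otimes> s) \<odot>\<^bsub>M\<^esub> v = r \<odot>\<^bsub>M\<^esub> (s \<odot>\<^bsub>M\<^esub> v)"
    and smult_one:
      "v \<in> carrier M \<Longrightarrow> \<one> \<odot>\<^bsub>M\<^esub> v = v"

definition left_module_hom ::
  "('r, 'x) ring_scheme \<Rightarrow> ('r, 'm, 'y) module_scheme \<Rightarrow> ('r, 'n, 'z) module_scheme \<Rightarrow> ('m \<Rightarrow> 'n) set"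
  where "left_module_hom R M N =
    {f \<in> carrier M \<rightarrow> carrier N.
       (\<forall>u\<in>carrier M. \<forall>v\<in>carrier M. f (u \<oplus>\<^bsub>M\<^esub> v) = f u \<oplus>\<^bsub>N\<^esub> f v) \<and>
       (\<forall>r\<in>carrier R. \<forall>v\<in>carrier M. f (r \<odot>\<^bsub>M\<^esub> v) = r \<odot>\<^bsub>N\<^esub> f v)}"

text \<open>\<^term>\<open>M\<close> is a left \<^term>\<open>R\<close>-module, free with basis \<^term>\<open>S\<close>.  The sum runs over the support
  because \<^const>\<open>finsum\<close> is meaningful over finite index sets only.\<close>

definition free_with_basis ::
  "('r, 'x) ring_scheme \<Rightarrow> ('r, 'm, 'y) module_scheme \<Rightarrow> 'm set \<Rightarrow> bool"
  where "free_with_basis R M S \<longleftrightarrow>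
    left_module R M \<and> S \<subseteq> carrier M \<and>
    (\<forall>v\<in>carrier M. \<exists>!c. c \<in> S \<rightarrow>\<^sub>E carrier R \<and> finite {x \<in> S. c x \<noteq> \<zero>\<^bsub>R\<^esub>} \<and>
       v = (\<Oplus>\<^bsub>M\<^esub>x\<in>{x \<in> S. c x \<noteq> \<zero>\<^bsub>R\<^esub>}. c x \<odot>\<^bsub>M\<^esub> x))"

definition free_left_module :: "('r, 'x) ring_scheme \<Rightarrow> ('r, 'm, 'y) module_scheme \<Rightarrow> bool"
  where "free_left_module R M \<longleftrightarrow> (\<exists>S. free_with_basis R M S)"

definition exact_at ::
  "('l, 'x) ring_scheme \<Rightarrow> ('l \<Rightarrow> 'm) \<Rightarrow> ('m, 'y) ring_scheme \<Rightarrow> ('m \<Rightarrow> 'n) \<Rightarrow> ('n, 'z) ring_scheme \<Rightarrow> bool"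
  where "exact_at L f M g N \<longleftrightarrow> f ` carrier L = a_kernel M N g"

text \<open>\<open>0 \<rightarrow> P\<^sub>3 \<rightarrow> P\<^sub>2 \<rightarrow> P\<^sub>1 \<rightarrow> P\<^sub>0 \<rightarrow> M \<rightarrow> 0\<close> with maps \<open>d\<^sub>3, d\<^sub>2, d\<^sub>1, e\<close> is a free resolution of
  the left \<open>R\<close>-module \<open>M\<close>.\<close>

definition free_resolution_length_3 ::
  "('r, 'x) ring_scheme \<Rightarrow>
   ('r, 'p3, 'x3) module_scheme \<Rightarrow> ('p3 \<Rightarrow> 'p2) \<Rightarrow>
   ('r, 'p2, 'x2) module_scheme \<Rightarrow> ('p2 \<Rightarrow> 'p1) \<Rightarrow>
   ('r, 'p1, 'x1) module_scheme \<Rightarrow> ('p1 \<Rightarrow> 'p0) \<Rightarrow>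
   ('r, 'p0, 'x0) module_scheme \<Rightarrow> ('p0 \<Rightarrow> 'm) \<Rightarrow>
   ('r, 'm, 'y) module_scheme \<Rightarrow> bool"
  where "free_resolution_length_3 R P\<^sub>3 d\<^sub>3 P\<^sub>2 d\<^sub>2 P\<^sub>1 d\<^sub>1 P\<^sub>0 e M \<longleftrightarrow>
    left_module R M \<and>
    free_left_module R P\<^sub>0 \<and> free_left_module R P\<^sub>1 \<and>
    free_left_module R P\<^sub>2 \<and> free_left_module R P\<^sub>3 \<and>
    d\<^sub>3 \<in> left_module_hom R P\<^sub>3 P\<^sub>2 \<and> d\<^sub>2 \<in> left_module_hom R P\<^sub>2 P\<^sub>1 \<and>
    d\<^sub>1 \<in> left_module_hom R P\<^sub>1 P\<^sub>0 \<and> e \<in> left_module_hom R P\<^sub>0 M \<and>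
    a_kernel P\<^sub>3 P\<^sub>2 d\<^sub>3 = {\<zero>\<^bsub>P\<^sub>3\<^esub>} \<and>
    exact_at P\<^sub>3 d\<^sub>3 P\<^sub>2 d\<^sub>2 P\<^sub>1 \<and>
    exact_at P\<^sub>2 d\<^sub>2 P\<^sub>1 d\<^sub>1 P\<^sub>0 \<and>
    exact_at P\<^sub>1 d\<^sub>1 P\<^sub>0 e M \<and>
    e ` carrier P\<^sub>0 = carrier M"


section \<open>Integral group rings\<close>

text \<open>The additive group is \<^term>\<open>free_Abelian_group (carrier G)\<close>; the group element \<open>g\<close> is
  \<^term>\<open>frag_of g\<close>, and the product is the bilinear extension of the product of \<open>G\<close>.\<close>

definition group_ring :: "('g, 'x) monoid_scheme \<Rightarrow> ('g \<Rightarrow>\<^sub>0 int) ring"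
  where "group_ring G =
    \<lparr>carrier = {c. Poly_Mapping.keys c \<subseteq> carrier G},
     monoid.mult = (\<lambda>u v. frag_extend (\<lambda>g. frag_extend (\<lambda>h. frag_of (g \<otimes>\<^bsub>G\<^esub> h)) v) u),
     one = frag_of \<one>\<^bsub>G\<^esub>, ring.zero = 0, ring.add = (+)\<rparr>"

lemma frag_extend_add_fun:
  "frag_extend (\<lambda>g. f g + h g) u = frag_extend f u + frag_extend h u"
  by (simp add: frag_extend_def frag_cmul_distrib2 sum.distrib)

lemma frag_extend_comp:
  "frag_extend f (frag_extend h u) = frag_extend (\<lambda>g. frag_extend f (h g)) u"
  using subset_UNIV[of "Poly_Mapping.keys u"]
  by (induction u rule: frag_induction) (auto simp: frag_extend_diff)

lemma ring_group_ring:
  fixes G (structure)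
  assumes "group G" shows "ring (group_ring G)"
proof -
  interpret group G by fact
  show ?thesis
  proof (rule ringI)
    show "abelian_group (group_ring G)"
    proof (rule abelian_groupI)
      fix x assume "x \<in> carrier (group_ring G)"
      then show "\<exists>y\<in>carrier (group_ring G). y \<oplus>\<^bsub>group_ring G\<^esub> x = \<zero>\<^bsub>group_ring G\<^esub>"
        by (intro bexI[of _ "- x"]) (auto simp: group_ring_def)
    qed (use keys_add in \<open>fastforce simp: group_ring_def add.assoc add.commute\<close>)+
    show "monoid (group_ring G)"
    proof (rule monoidI)
      fix x y assume xy: "x \<in> carrier (group_ring G)" "y \<in> carrier (group_ring G)"
      have "Poly_Mapping.keys (frag_extend (\<lambda>g. frag_extend (\<lambda>h. frag_of (g \<otimes> h)) y) x) \<subseteq> 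
        (\<Union>g\<in>Poly_Mapping.keys x. \<Union>h\<in>Poly_Mapping.keys y. {g \<otimes> h})"
        by (rule order.trans[OF keys_frag_extend] UN_mono order.refl)+ (auto simp: keys_frag_of)
      also have "\<dots> \<subseteq> carrier G" using xy by (auto simp: group_ring_def)
      finally show "x \<otimes>\<^bsub>group_ring G\<^esub> y \<in> carrier (group_ring G)"
        by (simp add: group_ring_def)
    next
      fix x y z assume xyz: "x \<in> carrier (group_ring G)" "y \<in> carrier (group_ring G)" "z \<in> carrier (group_ring G)"
      then show "x \<otimes>\<^bsub>group_ring G\<^esub> y \<otimes>\<^bsub>group_ring G\<^esub> z = x \<otimes>\<^bsub>group_ring G\<^esub> (y \<otimes>\<^bsub>group_ring G\<^esub> z)"
        by (auto simp: group_ring_def frag_extend_comp subset_iff m_assoc intro!: frag_extend_eq)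
    next
      fix x assume "x \<in> carrier (group_ring G)"
      then have "Poly_Mapping.keys x \<subseteq> carrier G" by (simp add: group_ring_def)
      then have *: "frag_extend (\<lambda>h. frag_of (\<one> \<otimes> h)) x = x" 
          "frag_extend (\<lambda>h. frag_of (h \<otimes> \<one>)) x = x"
        by (auto intro!: trans[OF frag_extend_eq frag_expansion[symmetric]])
      show "\<one>\<^bsub>group_ring G\<^esub> \<otimes>\<^bsub>group_ring G\<^esub> x = x" "x \<otimes>\<^bsub>group_ring G\<^esub> \<one>\<^bsub>group_ring G\<^esub> = x"
        using * by (simp_all add: group_ring_def)
    qed (simp add: group_ring_def keys_frag_of)
  qed (auto simp: group_ring_def frag_extend_add frag_extend_add_fun)
qed

text \<open>The trivial module: every group element acts on the integers as the identity, so a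
  group-ring element acts as multiplication by its coefficient sum.\<close>

definition augmentation :: "('g \<Rightarrow>\<^sub>0 int) \<Rightarrow> int"
  where "augmentation c = (\<Sum>g\<in>Poly_Mapping.keys c. Poly_Mapping.lookup c g)"

definition trivial_module :: "('g \<Rightarrow>\<^sub>0 int, int) module"
  where "trivial_module =
    \<lparr>carrier = UNIV, monoid.mult = (*), one = 1, ring.zero = 0, ring.add = (+),
     smult = (\<lambda>c z. augmentation c * z)\<rparr>"

lemma augmentation_lookup: "augmentation c = Poly_Mapping.lookup (frag_extend (\<lambda>_. frag_of ()) c) ()"
  unfolding frag_extend_def augmentation_def by (simp add: lookup_sum)

lemma augmentation_add: "augmentation (c + d) = augmentation c + augmentation d"
  by (simp add: augmentation_lookup frag_extend_add lookup_add)

lemma augmentation_diff: "augmentation (c - d) = augmentation c - augmentation d"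
  by (simp add: augmentation_lookup frag_extend_diff lookup_minus)

lemma augmentation_of: "augmentation (frag_of g) = 1" by (simp add: augmentation_lookup)

lemma augmentation_zero: "augmentation 0 = 0" by (simp add: augmentation_lookup)

lemma augmentation_translate: "augmentation (frag_extend (\<lambda>h. frag_of (m g h)) v) = augmentation v"
  by (simp add: augmentation_lookup frag_extend_comp)

lemma augmentation_mult:
  "augmentation (frag_extend (\<lambda>g. frag_extend (\<lambda>h. frag_of (m g h)) v) u) = augmentation u * augmentation v"
  using subset_UNIV[of "Poly_Mapping.keys u"]
  by (induction u rule: frag_induction) (auto simp: frag_extend_diff augmentation_diff
    augmentation_of augmentation_zero augmentation_translate algebra_simps)

lemma left_module_trivial_module:
  assumes "group G" shows "left_module (group_ring G) trivial_module"
proof -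
  have "abelian_group (trivial_module :: ('a \<Rightarrow>\<^sub>0 int, int) module)"
  proof (rule abelian_groupI)
    fix z assume "z \<in> carrier (trivial_module :: ('a \<Rightarrow>\<^sub>0 int, int) module)"
    show "\<exists>y\<in>carrier (trivial_module :: ('a \<Rightarrow>\<^sub>0 int, int) module).
        y \<oplus>\<^bsub>trivial_module :: ('a \<Rightarrow>\<^sub>0 int, int) module\<^esub> z
          = \<zero>\<^bsub>trivial_module :: ('a \<Rightarrow>\<^sub>0 int, int) module\<^esub>"
      by (rule bexI[of _ "- z"]) (simp_all add: trivial_module_def)
  qed (simp_all add: trivial_module_def)
  moreover have "left_module_axioms (group_ring G) trivial_module"
    by (rule left_module_axioms.intro)
      (simp_all add: trivial_module_def group_ring_def augmentation_add augmentation_mult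
        augmentation_of distrib_left distrib_right)
  ultimately show ?thesis
    using ring_group_ring[OF assms] by (simp add: left_module_def)
qed


section \<open>The semidirect product\<close>

definition semidirect_product ::
  "('n, 'x) monoid_scheme \<Rightarrow> ('h, 'y) monoid_scheme \<Rightarrow> ('h \<Rightarrow> 'n \<Rightarrow> 'n) \<Rightarrow> ('n \<times> 'h) monoid"
  where "semidirect_product N H \<phi> =
    \<lparr>carrier = carrier N \<times> carrier H,
     monoid.mult = (\<lambda>(g, k) (h, l). (g \<otimes>\<^bsub>N\<^esub> \<phi> k h, k \<otimes>\<^bsub>H\<^esub> l)),
     one = (\<one>\<^bsub>N\<^esub>, \<one>\<^bsub>H\<^esub>)\<rparr>"

abbreviation Z2 :: "(int \<times> int) monoid"
  where "Z2 \<equiv> integer_group \<times>\<times> integer_group"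

text \<open>The pair \<open>(m, n)\<close> stands for \<open>a\<^sup>m b\<^sup>n\<close>.  The columns of \<open>\<theta>\<close> are the images of \<open>a\<close> and \<open>b\<close>,
  that is \<open>\<theta> = [[\<alpha>, \<gamma>], [\<beta>, \<delta>]]\<close>.\<close>

abbreviation alpha :: "int^2^2 \<Rightarrow> int" where "alpha \<theta> \<equiv> \<theta> $ 1 $ 1"
abbreviation beta :: "int^2^2 \<Rightarrow> int" where "beta \<theta> \<equiv> \<theta> $ 2 $ 1"
abbreviation gamma :: "int^2^2 \<Rightarrow> int" where "gamma \<theta> \<equiv> \<theta> $ 1 $ 2"
abbreviation delta :: "int^2^2 \<Rightarrow> int" where "delta \<theta> \<equiv> \<theta> $ 2 $ 2"

definition act :: "int^2^2 \<Rightarrow> int \<times> int \<Rightarrow> int \<times> int"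
  where "act \<theta> = (\<lambda>(m, n). (alpha \<theta> * m + gamma \<theta> * n, beta \<theta> * m + delta \<theta> * n))"

text \<open>\<open>((m, n), k)\<close> stands for \<open>(a\<^sup>m b\<^sup>n, t\<^sup>k)\<close>.\<close>

definition torus_bundle_group :: "int^2^2 \<Rightarrow> ((int \<times> int) \<times> int) monoid"
  where "torus_bundle_group \<theta> =
    semidirect_product Z2 integer_group (\<lambda>k. act \<theta> [^]\<^bsub>AutoGroup Z2\<^esub> (k::int))"

lemma group_semidirect_product:
  assumes "group N" "group H" and \<phi>: "\<phi> \<in> hom H (AutoGroup N)"
  shows "group (semidirect_product N H \<phi>)"
proof -
  interpret N: group N by fact
  interpret H: group H by fact
  interpret A: group "AutoGroup N" by (rule N.AutoGroup)
  interpret h: group_hom H "AutoGroup N" \<phi> 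
    using \<phi> by unfold_locales auto
  have aut: "\<phi> k \<in> auto N" if "k \<in> carrier H" for k
    using h.hom_closed[OF that] by (simp add: AutoGroup_def)
  have hom: "\<phi> k \<in> hom N N" if "k \<in> carrier H" for k
    using aut[OF that] by (simp add: auto_def)
  have cl: "\<phi> k g \<in> carrier N" if "k \<in> carrier H" "g \<in> carrier N" for k g
    using hom[OF that(1)] that(2) by (auto simp: hom_def)
  note mu = hom_mult[OF hom]
  have comp: "\<phi> (k \<otimes>\<^bsub>H\<^esub> l) g = \<phi> k (\<phi> l g)" 
    if "k \<in> carrier H" "l \<in> carrier H" "g \<in> carrier N" for k l g
    using that aut[of k] aut[of l] 
    by (simp add: AutoGroup_def BijGroup_def auto_def compose_def)
  have one: "\<phi> \<one>\<^bsub>H\<^esub> g = g" if "g \<in> carrier N" for g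
    using that by (simp add: AutoGroup_def BijGroup_def)
  show ?thesis
  proof (rule groupI)
    fix x assume "x \<in> carrier (semidirect_product N H \<phi>)"
    then obtain g k where [simp]: "x = (g, k)" "g \<in> carrier N" "k \<in> carrier H"
      by (auto simp: semidirect_product_def)
    show "\<exists>y\<in>carrier (semidirect_product N H \<phi>).
       y \<otimes>\<^bsub>semidirect_product N H \<phi>\<^esub> x = \<one>\<^bsub>semidirect_product N H \<phi>\<^esub>"
      by (rule bexI[of _ "(inv\<^bsub>N\<^esub> (\<phi> (inv\<^bsub>H\<^esub> k) g), inv\<^bsub>H\<^esub> k)"])
        (auto simp: semidirect_product_def cl simp del: h.hom_inv)
  qed (auto simp: semidirect_product_def N.m_assoc H.m_assoc cl mu comp one simp del: h.hom_mult h.hom_one)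
qed

lemma group_Z2: "group Z2" by (simp add: DirProd_group)

lemma act_mult: "act (A ** B) p = act A (act B p)"
  by (cases p) (auto simp: act_def matrix_matrix_mult_def sum_2 algebra_simps)

lemma act_1: "act (mat 1) p = p"
  by (cases p) (auto simp: act_def mat_def)

lemma act_auto:
  assumes "invertible \<theta>" shows "act \<theta> \<in> carrier (AutoGroup Z2)"
proof -
  obtain A where A: "\<theta> ** A = mat 1" "A ** \<theta> = mat 1"
    using assms by (auto simp: invertible_def)
  have "bij (act \<theta>)"
    by (rule o_bij[where g="act A"]) (auto simp: fun_eq_iff act_mult[symmetric] A act_1)
  then show ?thesis
    by (auto simp: AutoGroup_def auto_def Bij_def hom_def act_def algebra_simps DirProd_def)
qed

lemma group_torus_bundle_group:
  assumes "invertible \<theta>" shows "group (torus_bundle_group \<theta>)"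
  unfolding torus_bundle_group_def
proof (rule group_semidirect_product)
  show "(\<lambda>k. act \<theta> [^]\<^bsub>AutoGroup Z2\<^esub> (k::int)) \<in> hom integer_group (AutoGroup Z2)"
    by (rule group.hom_integer_group_pow[OF group.AutoGroup[OF group_Z2] act_auto[OF assms]])
qed (simp_all add: group_Z2)

abbreviation torus_bundle_ring :: "int^2^2 \<Rightarrow> ((int \<times> int) \<times> int \<Rightarrow>\<^sub>0 int) ring"
  where "torus_bundle_ring \<theta> \<equiv> group_ring (torus_bundle_group \<theta>)"


section \<open>The coefficients of the boundary maps\<close>

abbreviation elt :: "int \<Rightarrow> int \<Rightarrow> int \<Rightarrow> ((int \<times> int) \<times> int \<Rightarrow>\<^sub>0 int)"
  where "elt m n k \<equiv> frag_of ((m, n), k)"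

definition m\<^sub>1 :: "int^2^2 \<Rightarrow> int" where "m\<^sub>1 \<theta> = (- matrix_inv \<theta>) $ 1 $ 1"
definition m\<^sub>2 :: "int^2^2 \<Rightarrow> int" where "m\<^sub>2 \<theta> = (- matrix_inv \<theta>) $ 1 $ 2"
definition n\<^sub>1 :: "int^2^2 \<Rightarrow> int" where "n\<^sub>1 \<theta> = (- matrix_inv \<theta>) $ 2 $ 1"
definition n\<^sub>2 :: "int^2^2 \<Rightarrow> int" where "n\<^sub>2 \<theta> = (- matrix_inv \<theta>) $ 2 $ 2"

lemma minus_matrix_inv_entries:
  fixes \<theta> :: "int^2^2" assumes "invertible \<theta>"
  defines "d \<equiv> alpha \<theta> * delta \<theta> - beta \<theta> * gamma \<theta>"
  shows "m\<^sub>1 \<theta> * d = - delta \<theta>" "m\<^sub>2 \<theta> * d = gamma \<theta>" "n\<^sub>1 \<theta> * d = beta \<theta>" "n\<^sub>2 \<theta> * d = - alpha \<theta>" 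
proof -
  have "\<theta> ** matrix_inv \<theta> = mat 1" 
    using assms(1) unfolding invertible_def matrix_inv_def by (rule someI2_ex) auto
  then have e: "(\<theta> ** matrix_inv \<theta>) $ i $ j = mat 1 $ i $ j" for i j by simp
  have E: "alpha \<theta> * m\<^sub>1 \<theta> + gamma \<theta> * n\<^sub>1 \<theta> = -1" "beta \<theta> * m\<^sub>1 \<theta> + delta \<theta> * n\<^sub>1 \<theta> = 0"
     "alpha \<theta> * m\<^sub>2 \<theta> + gamma \<theta> * n\<^sub>2 \<theta> = 0" "beta \<theta> * m\<^sub>2 \<theta> + delta \<theta> * n\<^sub>2 \<theta> = -1"
    using e[of 1 1] e[of 2 1] e[of 1 2] e[of 2 2]
    by (auto simp: matrix_matrix_mult_def sum_2 mat_def m\<^sub>1_def m\<^sub>2_def n\<^sub>1_def n\<^sub>2_def)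
  have "m\<^sub>1 \<theta> * d = delta \<theta> * (alpha \<theta> * m\<^sub>1 \<theta> + gamma \<theta> * n\<^sub>1 \<theta>) - gamma \<theta> * (beta \<theta> * m\<^sub>1 \<theta> + delta \<theta> * n\<^sub>1 \<theta>)"
    by (simp add: d_def algebra_simps)
  then show "m\<^sub>1 \<theta> * d = - delta \<theta>" by (simp add: E)
  have "m\<^sub>2 \<theta> * d = delta \<theta> * (alpha \<theta> * m\<^sub>2 \<theta> + gamma \<theta> * n\<^sub>2 \<theta>) - gamma \<theta> * (beta \<theta> * m\<^sub>2 \<theta> + delta \<theta> * n\<^sub>2 \<theta>)"
    by (simp add: d_def algebra_simps)
  then show "m\<^sub>2 \<theta> * d = gamma \<theta>" by (simp add: E)
  have "n\<^sub>1 \<theta> * d = alpha \<theta> * (beta \<theta> * m\<^sub>1 \<theta> + delta \<theta> * n\<^sub>1 \<theta>) - beta \<theta> * (alpha \<theta> * m\<^sub>1 \<theta> + gamma \<theta> * n\<^sub>1 \<theta>)"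
    by (simp add: d_def algebra_simps)
  then show "n\<^sub>1 \<theta> * d = beta \<theta>" by (simp add: E)
  have "n\<^sub>2 \<theta> * d = alpha \<theta> * (beta \<theta> * m\<^sub>2 \<theta> + delta \<theta> * n\<^sub>2 \<theta>) - beta \<theta> * (alpha \<theta> * m\<^sub>2 \<theta> + gamma \<theta> * n\<^sub>2 \<theta>)"
    by (simp add: d_def algebra_simps)
  then show "n\<^sub>2 \<theta> * d = - alpha \<theta>" by (simp add: E)
qed

definition coeff_A :: "int^2^2 \<Rightarrow> ((int \<times> int) \<times> int \<Rightarrow>\<^sub>0 int)"
  where "coeff_A \<theta> =
    (if m\<^sub>1 \<theta> > 0 then elt 0 0 0 + (\<Sum>k\<in>{1..m\<^sub>1 \<theta>}. elt (- k * alpha \<theta>) (- k * beta \<theta>) 1)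
     else if m\<^sub>1 \<theta> < 0 then elt 0 0 0 - (\<Sum>k\<in>{0..- m\<^sub>1 \<theta> - 1}. elt (k * alpha \<theta>) (k * beta \<theta>) 1)
     else elt 0 0 0)"

definition coeff_B :: "int^2^2 \<Rightarrow> ((int \<times> int) \<times> int \<Rightarrow>\<^sub>0 int)"
  where "coeff_B \<theta> =
    (if n\<^sub>1 \<theta> > 0 then (\<Sum>k\<in>{0..n\<^sub>1 \<theta> - 1}. elt (1 + k * gamma \<theta>) (k * delta \<theta>) 1)
     else if n\<^sub>1 \<theta> < 0 then - (\<Sum>k\<in>{1..- n\<^sub>1 \<theta>}. elt (1 - k * gamma \<theta>) (- k * delta \<theta>) 1)
     else 0)"

definition coeff_C :: "int^2^2 \<Rightarrow> ((int \<times> int) \<times> int \<Rightarrow>\<^sub>0 int)"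
  where "coeff_C \<theta> =
    (if m\<^sub>2 \<theta> > 0 then (\<Sum>k\<in>{1..m\<^sub>2 \<theta>}. elt (- k * alpha \<theta>) (- k * beta \<theta>) 1)
     else if m\<^sub>2 \<theta> < 0 then - (\<Sum>k\<in>{0..- m\<^sub>2 \<theta> - 1}. elt (k * alpha \<theta>) (k * beta \<theta>) 1)
     else 0)"

definition coeff_D :: "int^2^2 \<Rightarrow> ((int \<times> int) \<times> int \<Rightarrow>\<^sub>0 int)"
  where "coeff_D \<theta> =
    (if n\<^sub>2 \<theta> > 0 then elt 0 0 0 + (\<Sum>k\<in>{0..n\<^sub>2 \<theta> - 1}. elt (k * gamma \<theta>) (1 + k * delta \<theta>) 1)
     else if n\<^sub>2 \<theta> < 0 then elt 0 0 0 - (\<Sum>k\<in>{1..- n\<^sub>2 \<theta>}. elt (- k * gamma \<theta>) (1 - k * delta \<theta>) 1)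
     else elt 0 0 0)"

text \<open>\<open>E_table m\<^sub>1 n\<^sub>1 m\<^sub>2 n\<^sub>2 I\<^sub>1 J\<^sub>1 I\<^sub>2 J\<^sub>2\<close> (in this order of the integers): some row of the table
  applies and lists these index sets.  An empty product is rendered by two empty sets.\<close>

inductive E_table ::
  "int \<Rightarrow> int \<Rightarrow> int \<Rightarrow> int \<Rightarrow> int set \<Rightarrow> int set \<Rightarrow> int set \<Rightarrow> int set \<Rightarrow> bool"
  for m\<^sub>1 n\<^sub>1 m\<^sub>2 n\<^sub>2 :: int
  where
  "\<lbrakk>m\<^sub>1 > 0; n\<^sub>1 > 0; m\<^sub>2 > 0; n\<^sub>2 > 0; m\<^sub>1 \<le> m\<^sub>2; n\<^sub>1 \<le> n\<^sub>2\<rbrakk> \<Longrightarrow>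
     E_table m\<^sub>1 n\<^sub>1 m\<^sub>2 n\<^sub>2 {-m\<^sub>1-m\<^sub>2..-m\<^sub>2-1} {-n\<^sub>2..-n\<^sub>1-1} {-m\<^sub>2..-m\<^sub>1-1} {-n\<^sub>1..-1}"
| "\<lbrakk>m\<^sub>1 > 0; n\<^sub>1 > 0; m\<^sub>2 > 0; n\<^sub>2 > 0; m\<^sub>1 \<ge> m\<^sub>2; n\<^sub>1 \<ge> n\<^sub>2\<rbrakk> \<Longrightarrow>
     E_table m\<^sub>1 n\<^sub>1 m\<^sub>2 n\<^sub>2 {-m\<^sub>1..-m\<^sub>2-1} {-n\<^sub>2..-1} {-m\<^sub>1-m\<^sub>2..-m\<^sub>1-1} {-n\<^sub>1..-n\<^sub>2-1}"
| "\<lbrakk>m\<^sub>1 < 0; n\<^sub>1 < 0; m\<^sub>2 < 0; n\<^sub>2 < 0; m\<^sub>1 \<ge> m\<^sub>2; n\<^sub>1 \<ge> n\<^sub>2\<rbrakk> \<Longrightarrow>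
     E_table m\<^sub>1 n\<^sub>1 m\<^sub>2 n\<^sub>2 {-m\<^sub>2..-m\<^sub>1-m\<^sub>2-1} {-n\<^sub>1..-n\<^sub>2-1} {-m\<^sub>1..-m\<^sub>2-1} {0..-n\<^sub>1-1}"
| "\<lbrakk>m\<^sub>1 < 0; n\<^sub>1 < 0; m\<^sub>2 < 0; n\<^sub>2 < 0; m\<^sub>1 \<le> m\<^sub>2; n\<^sub>1 \<le> n\<^sub>2\<rbrakk> \<Longrightarrow>
     E_table m\<^sub>1 n\<^sub>1 m\<^sub>2 n\<^sub>2 {-m\<^sub>2..-m\<^sub>1-1} {0..-n\<^sub>2-1} {-m\<^sub>1..-m\<^sub>1-m\<^sub>2-1} {-n\<^sub>2..-n\<^sub>1-1}"
| "\<lbrakk>m\<^sub>1 < 0; n\<^sub>1 > 0; m\<^sub>2 > 0; n\<^sub>2 < 0\<rbrakk> \<Longrightarrow>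
     E_table m\<^sub>1 n\<^sub>1 m\<^sub>2 n\<^sub>2 {-m\<^sub>2..-m\<^sub>1-m\<^sub>2-1} {0..-n\<^sub>2-1} {-m\<^sub>1-m\<^sub>2..-m\<^sub>1-1} {-n\<^sub>1..-1}"
| "\<lbrakk>m\<^sub>1 > 0; n\<^sub>1 < 0; m\<^sub>2 < 0; n\<^sub>2 > 0\<rbrakk> \<Longrightarrow>
     E_table m\<^sub>1 n\<^sub>1 m\<^sub>2 n\<^sub>2 {-m\<^sub>1-m\<^sub>2..-m\<^sub>2-1} {-n\<^sub>2..-1} {-m\<^sub>1..-m\<^sub>1-m\<^sub>2-1} {0..-n\<^sub>1-1}"
| "\<lbrakk>m\<^sub>1 > 0; n\<^sub>1 < 0; m\<^sub>2 > 0; n\<^sub>2 < 0; m\<^sub>1 \<le> m\<^sub>2; n\<^sub>1 \<ge> n\<^sub>2\<rbrakk> \<Longrightarrow>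
     E_table m\<^sub>1 n\<^sub>1 m\<^sub>2 n\<^sub>2 {-m\<^sub>2..-m\<^sub>1-1} {0..-n\<^sub>1-1} {-m\<^sub>1-m\<^sub>2..-m\<^sub>2-1} {-n\<^sub>1..-n\<^sub>2-1}"
| "\<lbrakk>m\<^sub>1 > 0; n\<^sub>1 < 0; m\<^sub>2 > 0; n\<^sub>2 < 0; m\<^sub>1 \<ge> m\<^sub>2; n\<^sub>1 \<le> n\<^sub>2\<rbrakk> \<Longrightarrow>
     E_table m\<^sub>1 n\<^sub>1 m\<^sub>2 n\<^sub>2 {-m\<^sub>1-m\<^sub>2..-m\<^sub>1-1} {-n\<^sub>2..-n\<^sub>1-1} {-m\<^sub>1..-m\<^sub>2-1} {0..-n\<^sub>2-1}"
| "\<lbrakk>m\<^sub>1 < 0; n\<^sub>1 > 0; m\<^sub>2 < 0; n\<^sub>2 > 0; m\<^sub>1 \<le> m\<^sub>2; n\<^sub>1 \<ge> n\<^sub>2\<rbrakk> \<Longrightarrow>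
     E_table m\<^sub>1 n\<^sub>1 m\<^sub>2 n\<^sub>2 {-m\<^sub>1..-m\<^sub>1-m\<^sub>2-1} {-n\<^sub>1..-n\<^sub>2-1} {-m\<^sub>2..-m\<^sub>1-1} {-n\<^sub>2..-1}"
| "\<lbrakk>m\<^sub>1 < 0; n\<^sub>1 > 0; m\<^sub>2 < 0; n\<^sub>2 > 0; m\<^sub>1 \<ge> m\<^sub>2; n\<^sub>1 \<le> n\<^sub>2\<rbrakk> \<Longrightarrow>
     E_table m\<^sub>1 n\<^sub>1 m\<^sub>2 n\<^sub>2 {-m\<^sub>1..-m\<^sub>2-1} {-n\<^sub>1..-1} {-m\<^sub>2..-m\<^sub>1-m\<^sub>2-1} {-n\<^sub>2..-n\<^sub>1-1}"
| "\<lbrakk>m\<^sub>1 > 0; n\<^sub>1 > 0; m\<^sub>2 < 0; n\<^sub>2 < 0\<rbrakk> \<Longrightarrow>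
     E_table m\<^sub>1 n\<^sub>1 m\<^sub>2 n\<^sub>2 {-m\<^sub>1..-m\<^sub>1-m\<^sub>2-1} {-n\<^sub>1..-1} {-m\<^sub>1-m\<^sub>2..-m\<^sub>2-1} {0..-n\<^sub>2-1}"
| "\<lbrakk>m\<^sub>1 < 0; n\<^sub>1 < 0; m\<^sub>2 > 0; n\<^sub>2 > 0\<rbrakk> \<Longrightarrow>
     E_table m\<^sub>1 n\<^sub>1 m\<^sub>2 n\<^sub>2 {-m\<^sub>1-m\<^sub>2..-m\<^sub>1-1} {0..-n\<^sub>1-1} {-m\<^sub>2..-m\<^sub>1-m\<^sub>2-1} {-n\<^sub>2..-1}"
| "\<lbrakk>m\<^sub>1 = 0; n\<^sub>1 = 1; m\<^sub>2 = 1\<rbrakk> \<Longrightarrow> E_table m\<^sub>1 n\<^sub>1 m\<^sub>2 n\<^sub>2 {} {} {-1} {-1}"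
| "\<lbrakk>m\<^sub>1 = 0; n\<^sub>1 = -1; m\<^sub>2 = -1\<rbrakk> \<Longrightarrow> E_table m\<^sub>1 n\<^sub>1 m\<^sub>2 n\<^sub>2 {} {} {0} {0}"
| "\<lbrakk>m\<^sub>1 = 0; n\<^sub>1 = 1; m\<^sub>2 = -1\<rbrakk> \<Longrightarrow> E_table m\<^sub>1 n\<^sub>1 m\<^sub>2 n\<^sub>2 {0} {-1} {} {}"
| "\<lbrakk>m\<^sub>1 = 0; n\<^sub>1 = -1; m\<^sub>2 = 1\<rbrakk> \<Longrightarrow> E_table m\<^sub>1 n\<^sub>1 m\<^sub>2 n\<^sub>2 {-1} {0} {} {}"
| "\<lbrakk>m\<^sub>1 = 1; n\<^sub>1 = 0; n\<^sub>2 = 1\<rbrakk> \<Longrightarrow> E_table m\<^sub>1 n\<^sub>1 m\<^sub>2 n\<^sub>2 {-m\<^sub>2-1} {-1} {} {}"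
| "\<lbrakk>m\<^sub>1 = -1; n\<^sub>1 = 0; n\<^sub>2 = -1\<rbrakk> \<Longrightarrow> E_table m\<^sub>1 n\<^sub>1 m\<^sub>2 n\<^sub>2 {-m\<^sub>2} {0} {} {}"
| "\<lbrakk>m\<^sub>1 = 1; n\<^sub>1 = 0; n\<^sub>2 = -1\<rbrakk> \<Longrightarrow> E_table m\<^sub>1 n\<^sub>1 m\<^sub>2 n\<^sub>2 {} {} {-m\<^sub>2-1} {0}"
| "\<lbrakk>m\<^sub>1 = -1; n\<^sub>1 = 0; n\<^sub>2 = 1\<rbrakk> \<Longrightarrow> E_table m\<^sub>1 n\<^sub>1 m\<^sub>2 n\<^sub>2 {} {} {-m\<^sub>2} {-1}"
| "\<lbrakk>m\<^sub>1 = 1; m\<^sub>2 = 0; n\<^sub>2 = 1\<rbrakk> \<Longrightarrow> E_table m\<^sub>1 n\<^sub>1 m\<^sub>2 n\<^sub>2 {-1} {-1} {} {}"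
| "\<lbrakk>m\<^sub>1 = -1; m\<^sub>2 = 0; n\<^sub>2 = -1\<rbrakk> \<Longrightarrow> E_table m\<^sub>1 n\<^sub>1 m\<^sub>2 n\<^sub>2 {0} {0} {} {}"
| "\<lbrakk>m\<^sub>1 = 1; m\<^sub>2 = 0; n\<^sub>2 = -1\<rbrakk> \<Longrightarrow> E_table m\<^sub>1 n\<^sub>1 m\<^sub>2 n\<^sub>2 {} {} {-1} {0}"
| "\<lbrakk>m\<^sub>1 = -1; m\<^sub>2 = 0; n\<^sub>2 = 1\<rbrakk> \<Longrightarrow> E_table m\<^sub>1 n\<^sub>1 m\<^sub>2 n\<^sub>2 {} {} {0} {-1}"
| "\<lbrakk>n\<^sub>1 = 1; m\<^sub>2 = 1; n\<^sub>2 = 0\<rbrakk> \<Longrightarrow> E_table m\<^sub>1 n\<^sub>1 m\<^sub>2 n\<^sub>2 {} {} {-m\<^sub>1-1} {-1}"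
| "\<lbrakk>n\<^sub>1 = -1; m\<^sub>2 = -1; n\<^sub>2 = 0\<rbrakk> \<Longrightarrow> E_table m\<^sub>1 n\<^sub>1 m\<^sub>2 n\<^sub>2 {} {} {-m\<^sub>1} {0}"
| "\<lbrakk>n\<^sub>1 = 1; m\<^sub>2 = -1; n\<^sub>2 = 0\<rbrakk> \<Longrightarrow> E_table m\<^sub>1 n\<^sub>1 m\<^sub>2 n\<^sub>2 {-m\<^sub>1} {-1} {} {}"
| "\<lbrakk>n\<^sub>1 = -1; m\<^sub>2 = 1; n\<^sub>2 = 0\<rbrakk> \<Longrightarrow> E_table m\<^sub>1 n\<^sub>1 m\<^sub>2 n\<^sub>2 {-m\<^sub>1-1} {0} {} {}"

text \<open>The definite description is meaningful because, for invertible \<open>\<theta>\<close>, at least one row applies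
  and all applicable rows give the same element.\<close>

definition coeff_E :: "int^2^2 \<Rightarrow> ((int \<times> int) \<times> int \<Rightarrow>\<^sub>0 int)"
  where "coeff_E \<theta> =
    (THE e. \<exists>I\<^sub>1 J\<^sub>1 I\<^sub>2 J\<^sub>2. E_table (m\<^sub>1 \<theta>) (n\<^sub>1 \<theta>) (m\<^sub>2 \<theta>) (n\<^sub>2 \<theta>) I\<^sub>1 J\<^sub>1 I\<^sub>2 J\<^sub>2 \<and>
       e = - elt 0 0 0
         + (\<Sum>(m, n)\<in>I\<^sub>1 \<times> J\<^sub>1. elt (alpha \<theta> * m + gamma \<theta> * n) (beta \<theta> * m + delta \<theta> * n) 1)
         - (\<Sum>(m, n)\<in>I\<^sub>2 \<times> J\<^sub>2. elt (alpha \<theta> * m + gamma \<theta> * n) (beta \<theta> * m + delta \<theta> * n) 1))"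

text \<open>The values of the augmentation \<open>e\<close> and of the boundary maps on the generators
  \<open>x\<close>; \<open>y\<^sub>1, y\<^sub>2, y\<^sub>3\<close>; \<open>z\<^sub>1, z\<^sub>2, z\<^sub>3\<close>; \<open>w\<close>.\<close>

definition boundary_maps ::
  "int^2^2 \<Rightarrow>
   ((int \<times> int) \<times> int \<Rightarrow>\<^sub>0 int, 'p0) module \<Rightarrow> 'p0 \<Rightarrow>
   ((int \<times> int) \<times> int \<Rightarrow>\<^sub>0 int, 'p1) module \<Rightarrow> 'p1 \<Rightarrow> 'p1 \<Rightarrow> 'p1 \<Rightarrow>
   ((int \<times> int) \<times> int \<Rightarrow>\<^sub>0 int, 'p2) module \<Rightarrow> 'p2 \<Rightarrow> 'p2 \<Rightarrow> 'p2 \<Rightarrow>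
   ((int \<times> int) \<times> int \<Rightarrow>\<^sub>0 int, 'p3) module \<Rightarrow> 'p3 \<Rightarrow>
   ('p0 \<Rightarrow> int) \<Rightarrow> ('p1 \<Rightarrow> 'p0) \<Rightarrow> ('p2 \<Rightarrow> 'p1) \<Rightarrow> ('p3 \<Rightarrow> 'p2) \<Rightarrow> bool"
  where "boundary_maps \<theta> P\<^sub>0 x P\<^sub>1 y\<^sub>1 y\<^sub>2 y\<^sub>3 P\<^sub>2 z\<^sub>1 z\<^sub>2 z\<^sub>3 P\<^sub>3 w e d\<^sub>1 d\<^sub>2 d\<^sub>3 \<longleftrightarrow>
    e \<in> left_module_hom (torus_bundle_ring \<theta>) P\<^sub>0 trivial_module \<and>
    d\<^sub>1 \<in> left_module_hom (torus_bundle_ring \<theta>) P\<^sub>1 P\<^sub>0 \<and>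
    d\<^sub>2 \<in> left_module_hom (torus_bundle_ring \<theta>) P\<^sub>2 P\<^sub>1 \<and>
    d\<^sub>3 \<in> left_module_hom (torus_bundle_ring \<theta>) P\<^sub>3 P\<^sub>2 \<and>
    e x = 1 \<and>
    d\<^sub>1 y\<^sub>1 = (elt 1 0 0 - elt 0 0 0) \<odot>\<^bsub>P\<^sub>0\<^esub> x \<and>
    d\<^sub>1 y\<^sub>2 = (elt 0 1 0 - elt 0 0 0) \<odot>\<^bsub>P\<^sub>0\<^esub> x \<and>
    d\<^sub>1 y\<^sub>3 = (elt 0 0 1 - elt 0 0 0) \<odot>\<^bsub>P\<^sub>0\<^esub> x \<and>
    d\<^sub>2 z\<^sub>1 = coeff_A \<theta> \<odot>\<^bsub>P\<^sub>1\<^esub> y\<^sub>1 \<oplus>\<^bsub>P\<^sub>1\<^esub> coeff_B \<theta> \<odot>\<^bsub>P\<^sub>1\<^esub> y\<^sub>2 \<oplus>\<^bsub>P\<^sub>1\<^esub> (elt 1 0 0 - elt 0 0 0) \<odot>\<^bsub>P\<^sub>1\<^esub> y\<^sub>3 \<and>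
    d\<^sub>2 z\<^sub>2 = coeff_C \<theta> \<odot>\<^bsub>P\<^sub>1\<^esub> y\<^sub>1 \<oplus>\<^bsub>P\<^sub>1\<^esub> coeff_D \<theta> \<odot>\<^bsub>P\<^sub>1\<^esub> y\<^sub>2 \<oplus>\<^bsub>P\<^sub>1\<^esub> (elt 0 1 0 - elt 0 0 0) \<odot>\<^bsub>P\<^sub>1\<^esub> y\<^sub>3 \<and>
    d\<^sub>2 z\<^sub>3 = (elt 0 0 0 - elt 0 1 0) \<odot>\<^bsub>P\<^sub>1\<^esub> y\<^sub>1 \<oplus>\<^bsub>P\<^sub>1\<^esub> (elt 1 0 0 - elt 0 0 0) \<odot>\<^bsub>P\<^sub>1\<^esub> y\<^sub>2 \<and>
    d\<^sub>3 w = (elt 0 0 0 - elt 0 1 0) \<odot>\<^bsub>P\<^sub>2\<^esub> z\<^sub>1 \<oplus>\<^bsub>P\<^sub>2\<^esub> (elt 1 0 0 - elt 0 0 0) \<odot>\<^bsub>P\<^sub>2\<^esub> z\<^sub>2 \<oplus>\<^bsub>P\<^sub>2\<^esub> coeff_E \<theta> \<odot>\<^bsub>P\<^sub>2\<^esub> z\<^sub>3"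

end

theory Submission
  imports Defs
begin

text \<open>The complex is the mapping cone of a chain map between two copies of the Koszul complex of
  \<open>(a - 1, b - 1)\<close>: the generators \<open>x; y\<^sub>1, y\<^sub>2; z\<^sub>3\<close> carry one copy, and \<open>y\<^sub>3; z\<^sub>1, z\<^sub>2; w\<close> the other,
  shifted by one.  The Koszul complex is exact in positive degrees because a finitely supported function
  invariant under a translation of infinite order vanishes, and its homology in degree 0 is the ring
  of Laurent polynomials in \<open>t\<close>, on which \<open>t - 1\<close> acts injectively.  A diagram chase then gives exactness.

  In the group ring, \<open>a - 1\<close> and \<open>b - 1\<close> are not right zero divisors, so the relations between the
  coefficients can be checked after multiplication by them; all sums then telescope.  In particular \<open>E\<close>
  is determined by \<open>E (b - 1) (a - 1)\<close>, which turns out not to depend on the row of the table.\<close>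

section \<open>Modules with a finite basis\<close>

context left_module
begin

lemma smult_zero_left: "v \<in> carrier M \<Longrightarrow> \<zero> \<odot>\<^bsub>M\<^esub> v = \<zero>\<^bsub>M\<^esub>"
  using smult_l_distr[of \<zero> \<zero> v] smult_closed[of \<zero> v] by (simp add: M.add.l_cancel_one)

lemma smult_zero_right: "r \<in> carrier R \<Longrightarrow> r \<odot>\<^bsub>M\<^esub> \<zero>\<^bsub>M\<^esub> = \<zero>\<^bsub>M\<^esub>"
  using smult_r_distr[of r "\<zero>\<^bsub>M\<^esub>" "\<zero>\<^bsub>M\<^esub>"] smult_closed[of r "\<zero>\<^bsub>M\<^esub>"] by (simp add: M.add.l_cancel_one)

lemma smult_finsum:
  assumes "finite A" "f \<in> A \<rightarrow> carrier M" "r \<in> carrier R"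
  shows "r \<odot>\<^bsub>M\<^esub> (\<Oplus>\<^bsub>M\<^esub>x\<in>A. f x) = (\<Oplus>\<^bsub>M\<^esub>x\<in>A. r \<odot>\<^bsub>M\<^esub> f x)"
  using assms
proof (induction A rule: finite_induct)
  case (insert x A)
  then have "f \<in> A \<rightarrow> carrier M" "f x \<in> carrier M" "(\<lambda>x. r \<odot>\<^bsub>M\<^esub> f x) \<in> A \<rightarrow> carrier M"
    by (auto intro: smult_closed)
  with insert show ?case
    by (simp add: M.finsum_insert smult_closed smult_r_distr)
qed (simp add: smult_zero_right)

end

context
  fixes R :: "('r, 'x) ring_scheme" and M :: "('r, 'm, 'y) module_scheme" and S :: "'m set"
  assumes free: "free_with_basis R M S" and fin: "finite S"
begin

interpretation left_module R M
  using free by (simp add: free_with_basis_def)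

lemma basis_closed: "x \<in> S \<Longrightarrow> x \<in> carrier M"
  using free by (auto simp: free_with_basis_def)

text \<open>For finite \<open>S\<close> the sum over the support extends to all of \<open>S\<close>,
  because the added terms are zero multiples. Later coordinate arguments therefore never mention
  supports.\<close>

lemma finite_basis_unique_coefficients:
  assumes "v \<in> carrier M"
  shows "\<exists>!c. c \<in> S \<rightarrow>\<^sub>E carrier R \<and> v = (\<Oplus>\<^bsub>M\<^esub>x\<in>S. c x \<odot>\<^bsub>M\<^esub> x)"
proof -
  have "(\<Oplus>\<^bsub>M\<^esub>x\<in>{x \<in> S. c x \<noteq> \<zero>\<^bsub>R\<^esub>}. c x \<odot>\<^bsub>M\<^esub> x) = (\<Oplus>\<^bsub>M\<^esub>x\<in>S. c x \<odot>\<^bsub>M\<^esub> x)"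
    if "c \<in> S \<rightarrow>\<^sub>E carrier R" for c
    using that fin
    by (intro M.add.finprod_mono_neutral_cong_left)
       (auto simp: smult_zero_left basis_closed intro!: smult_closed)
  then have "(c \<in> S \<rightarrow>\<^sub>E carrier R \<and> finite {x \<in> S. c x \<noteq> \<zero>\<^bsub>R\<^esub>} \<and>
       v = (\<Oplus>\<^bsub>M\<^esub>x\<in>{x \<in> S. c x \<noteq> \<zero>\<^bsub>R\<^esub>}. c x \<odot>\<^bsub>M\<^esub> x)) \<longleftrightarrow>
      (c \<in> S \<rightarrow>\<^sub>E carrier R \<and> v = (\<Oplus>\<^bsub>M\<^esub>x\<in>S. c x \<odot>\<^bsub>M\<^esub> x))" for c
    using fin by auto
  moreover have "\<exists>!c. c \<in> S \<rightarrow>\<^sub>E carrier R \<and> finite {x \<in> S. c x \<noteq> \<zero>\<^bsub>R\<^esub>} \<and>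
       v = (\<Oplus>\<^bsub>M\<^esub>x\<in>{x \<in> S. c x \<noteq> \<zero>\<^bsub>R\<^esub>}. c x \<odot>\<^bsub>M\<^esub> x)"
    using free assms by (simp add: free_with_basis_def)
  ultimately show ?thesis
    by simp
qed

text \<open>The universal property that supplies the boundary maps. \<open>h\<close> recombines the
  coordinates of \<open>v\<close> with the values \<open>f x\<close>; since coordinates are unique,
  those of a sum or a multiple are the pointwise ones, which gives linearity.\<close>

lemma finite_basis_hom_extension:
  assumes "left_module R N" and f: "\<And>x. x \<in> S \<Longrightarrow> f x \<in> carrier N"
  shows "\<exists>h\<in>left_module_hom R M N. \<forall>x\<in>S. h x = f x"
proof -
  interpret N: left_module R N by fact
  define lin where "lin c = (\<Oplus>\<^bsub>M\<^esub>x\<in>S. c x \<odot>\<^bsub>M\<^esub> x)" for c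
  define linN where "linN c = (\<Oplus>\<^bsub>N\<^esub>x\<in>S. c x \<odot>\<^bsub>N\<^esub> f x)" for c
  define coord where "coord v = (THE c. c \<in> S \<rightarrow>\<^sub>E carrier R \<and> v = lin c)" for v
  have coord: "coord v \<in> S \<rightarrow>\<^sub>E carrier R" "v = lin (coord v)" if "v \<in> carrier M" for v
    using theI'[OF finite_basis_unique_coefficients[OF that]] unfolding coord_def lin_def by auto
  have coord_eq: "coord v = c" if "v \<in> carrier M" "c \<in> S \<rightarrow>\<^sub>E carrier R" "v = lin c" for v c
    using the1_equality[OF finite_basis_unique_coefficients[OF that(1)], of c] that
    unfolding coord_def lin_def by auto
  have closed: "coord v x \<in> carrier R" if "v \<in> carrier M" "x \<in> S" for v x
    using coord(1)[OF that(1)] that(2) by auto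
  have linN_cong: "linN c = linN d" if "\<And>x. x \<in> S \<Longrightarrow> c x = d x" "\<And>x. x \<in> S \<Longrightarrow> d x \<in> carrier R" for c d
    unfolding linN_def using that by (intro N.M.finsum_cong') (auto intro: N.smult_closed f)
  have lin_cong: "lin c = lin d" if "\<And>x. x \<in> S \<Longrightarrow> c x = d x" "\<And>x. x \<in> S \<Longrightarrow> d x \<in> carrier R" for c d
    unfolding lin_def using that by (intro M.finsum_cong') (auto intro: smult_closed basis_closed)
  define h where "h v = linN (coord v)" for v
  have "h (u \<oplus>\<^bsub>M\<^esub> v) = h u \<oplus>\<^bsub>N\<^esub> h v" if u: "u \<in> carrier M" and v: "v \<in> carrier M" for u v
  proof -
    let ?c = "\<lambda>x\<in>S. coord u x \<oplus>\<^bsub>R\<^esub> coord v x"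
    have "u \<oplus>\<^bsub>M\<^esub> v = lin (coord u) \<oplus>\<^bsub>M\<^esub> lin (coord v)"
      using coord u v by simp
    also have "\<dots> = (\<Oplus>\<^bsub>M\<^esub>x\<in>S. coord u x \<odot>\<^bsub>M\<^esub> x \<oplus>\<^bsub>M\<^esub> coord v x \<odot>\<^bsub>M\<^esub> x)"
      unfolding lin_def using closed u v
      by (intro M.finsum_addf[symmetric]) (auto intro: smult_closed basis_closed)
    also have "\<dots> = lin ?c"
      unfolding lin_def using closed u v
      by (intro M.finsum_cong') (auto simp: smult_l_distr basis_closed intro!: smult_closed M.a_closed)
    finally have "coord (u \<oplus>\<^bsub>M\<^esub> v) = ?c"
      using u v closed by (intro coord_eq M.a_closed) auto
    then have "h (u \<oplus>\<^bsub>M\<^esub> v) = linN ?c"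
      by (simp add: h_def)
    also have "\<dots> = (\<Oplus>\<^bsub>N\<^esub>x\<in>S. coord u x \<odot>\<^bsub>N\<^esub> f x \<oplus>\<^bsub>N\<^esub> coord v x \<odot>\<^bsub>N\<^esub> f x)"
      unfolding linN_def using closed u v
      by (intro N.M.finsum_cong') (auto simp: N.smult_l_distr f intro!: N.smult_closed N.M.a_closed)
    also have "\<dots> = h u \<oplus>\<^bsub>N\<^esub> h v"
      unfolding h_def linN_def using closed u v
      by (intro N.M.finsum_addf) (auto intro: N.smult_closed f)
    finally show ?thesis .
  qed
  moreover have "h (r \<odot>\<^bsub>M\<^esub> v) = r \<odot>\<^bsub>N\<^esub> h v" if r: "r \<in> carrier R" and v: "v \<in> carrier M" for r v
  proof -
    let ?c = "\<lambda>x\<in>S. r \<otimes>\<^bsub>R\<^esub> coord v x"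
    have "r \<odot>\<^bsub>M\<^esub> v = r \<odot>\<^bsub>M\<^esub> lin (coord v)"
      using coord v by simp
    also have "\<dots> = (\<Oplus>\<^bsub>M\<^esub>x\<in>S. r \<odot>\<^bsub>M\<^esub> (coord v x \<odot>\<^bsub>M\<^esub> x))"
      unfolding lin_def using closed r v fin
      by (intro smult_finsum) (auto intro: smult_closed basis_closed)
    also have "\<dots> = lin ?c"
      unfolding lin_def using closed r v
      by (intro M.finsum_cong') (auto simp: smult_assoc1 basis_closed intro: smult_closed)
    finally have "coord (r \<odot>\<^bsub>M\<^esub> v) = ?c"
      using r v closed by (intro coord_eq smult_closed) auto
    then have "h (r \<odot>\<^bsub>M\<^esub> v) = linN ?c"
      by (simp add: h_def)
    also have "\<dots> = (\<Oplus>\<^bsub>N\<^esub>x\<in>S. r \<odot>\<^bsub>N\<^esub> (coord v x \<odot>\<^bsub>N\<^esub> f x))"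
      unfolding linN_def using closed r v
      by (intro N.M.finsum_cong') (auto simp: N.smult_assoc1 f intro!: N.smult_closed)
    also have "\<dots> = r \<odot>\<^bsub>N\<^esub> h v"
      unfolding h_def linN_def using closed r v fin
      by (intro N.smult_finsum[symmetric]) (auto intro: N.smult_closed f)
    finally show ?thesis .
  qed
  moreover have "h x = f x" if x: "x \<in> S" for x
  proof -
    let ?c = "\<lambda>y\<in>S. if x = y then \<one>\<^bsub>R\<^esub> else \<zero>\<^bsub>R\<^esub>"
    have "lin ?c = (\<Oplus>\<^bsub>M\<^esub>y\<in>S. if x = y then y else \<zero>\<^bsub>M\<^esub>)"
      unfolding lin_def
      by (intro M.finsum_cong') (auto simp: smult_one smult_zero_left basis_closed)
    also have "\<dots> = x"
      using x fin basis_closed by (intro M.finsum_singleton) auto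
    finally have "coord x = ?c"
      using x basis_closed by (intro coord_eq) auto
    then have "h x = linN ?c"
      by (simp add: h_def)
    also have "\<dots> = (\<Oplus>\<^bsub>N\<^esub>y\<in>S. if x = y then f y else \<zero>\<^bsub>N\<^esub>)"
      unfolding linN_def
      by (intro N.M.finsum_cong') (auto simp: N.smult_one N.smult_zero_left f)
    also have "\<dots> = f x"
      using x fin f by (intro N.M.finsum_singleton) auto
    finally show ?thesis .
  qed
  moreover have "h v \<in> carrier N" if "v \<in> carrier M" for v
    unfolding h_def linN_def using closed that
    by (intro N.M.finsum_closed) (auto intro: N.smult_closed f)
  ultimately show ?thesis
    by (intro bexI[of _ h]) (auto simp: left_module_hom_def)
qed

end

section \<open>Coordinates in free modules of rank three and one\<close>

abbreviation lin3 :: "('r, 'm, 'y) module_scheme \<Rightarrow> 'm \<Rightarrow> 'm \<Rightarrow> 'm \<Rightarrow> 'r \<Rightarrow> 'r \<Rightarrow> 'r \<Rightarrow> 'm"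
  where "lin3 M u v w p q r \<equiv> p \<odot>\<^bsub>M\<^esub> u \<oplus>\<^bsub>M\<^esub> q \<odot>\<^bsub>M\<^esub> v \<oplus>\<^bsub>M\<^esub> r \<odot>\<^bsub>M\<^esub> w"

context left_module
begin

lemma lin3_zero:
  assumes "u \<in> carrier M" "v \<in> carrier M" "w \<in> carrier M"
  shows "lin3 M u v w \<zero> \<zero> \<zero> = \<zero>\<^bsub>M\<^esub>"
  using assms by (simp add: smult_zero_left)

lemma smult_lin3:
  assumes "u \<in> carrier M" "v \<in> carrier M" "w \<in> carrier M"
    and "r \<in> carrier R" "p \<in> carrier R" "q \<in> carrier R" "s \<in> carrier R"
  shows "r \<odot>\<^bsub>M\<^esub> lin3 M u v w p q s = lin3 M u v w (r \<otimes> p) (r \<otimes> q) (r \<otimes> s)"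
  using assms by (simp add: smult_closed smult_r_distr smult_assoc1)

lemma lin3_add:
  assumes "u \<in> carrier M" "v \<in> carrier M" "w \<in> carrier M"
    and "p \<in> carrier R" "q \<in> carrier R" "s \<in> carrier R" "p' \<in> carrier R" "q' \<in> carrier R" "s' \<in> carrier R"
  shows "lin3 M u v w p q s \<oplus>\<^bsub>M\<^esub> lin3 M u v w p' q' s' = lin3 M u v w (p \<oplus> p') (q \<oplus> q') (s \<oplus> s')"
  using assms by (simp add: smult_closed smult_l_distr M.a_ac)

text \<open>A row vector times a matrix. A homomorphism of left modules acts on coordinates by
  multiplication from the right, so the outer scalars \<open>p\<close>, \<open>q\<close>,
  \<open>s\<close> stand first in every product.\<close>

lemma lin3_lin3:
  assumes "u \<in> carrier M" "v \<in> carrier M" "w \<in> carrier M"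
    and "p \<in> carrier R" "q \<in> carrier R" "s \<in> carrier R"
    and "p1 \<in> carrier R" "q1 \<in> carrier R" "s1 \<in> carrier R"
    and "p2 \<in> carrier R" "q2 \<in> carrier R" "s2 \<in> carrier R"
    and "p3 \<in> carrier R" "q3 \<in> carrier R" "s3 \<in> carrier R"
  shows "lin3 M (lin3 M u v w p1 q1 s1) (lin3 M u v w p2 q2 s2) (lin3 M u v w p3 q3 s3) p q s
    = lin3 M u v w (p \<otimes> p1 \<oplus> q \<otimes> p2 \<oplus> s \<otimes> p3) (p \<otimes> q1 \<oplus> q \<otimes> q2 \<oplus> s \<otimes> q3)
        (p \<otimes> s1 \<oplus> q \<otimes> s2 \<oplus> s \<otimes> s3)"
  using assms by (simp only: smult_lin3 lin3_add R.m_closed R.a_closed)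

lemma lin3_smult:
  assumes "u \<in> carrier M"
    and "p \<in> carrier R" "q \<in> carrier R" "s \<in> carrier R" "p' \<in> carrier R" "q' \<in> carrier R" "s' \<in> carrier R"
  shows "lin3 M (p' \<odot>\<^bsub>M\<^esub> u) (q' \<odot>\<^bsub>M\<^esub> u) (s' \<odot>\<^bsub>M\<^esub> u) p q s = (p \<otimes> p' \<oplus> q \<otimes> q' \<oplus> s \<otimes> s') \<odot>\<^bsub>M\<^esub> u"
  using assms by (simp add: smult_closed smult_l_distr smult_assoc1)

end

context
  fixes R :: "('r, 'x) ring_scheme" and M :: "('r, 'm, 'y) module_scheme" and u v w :: 'm
  assumes free: "free_with_basis R M {u, v, w}" and card: "card {u, v, w} = 3"
begin

interpretation left_module R M
  using free by (simp add: free_with_basis_def)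

lemma basis3_distinct: "u \<noteq> v" "u \<noteq> w" "v \<noteq> w"
  using card by (auto simp: card_insert_if split: if_splits)

lemma basis3_closed: "u \<in> carrier M" "v \<in> carrier M" "w \<in> carrier M"
  using basis_closed[OF free] by auto

text \<open>Cardinality three keeps the sum over the set from merging equal generators, so it has
  exactly three terms.\<close>

lemma finsum_basis3:
  assumes "c \<in> {u, v, w} \<rightarrow> carrier R"
  shows "(\<Oplus>\<^bsub>M\<^esub>x\<in>{u, v, w}. c x \<odot>\<^bsub>M\<^esub> x) = lin3 M u v w (c u) (c v) (c w)"
  using assms basis3_distinct basis3_closed
  by (simp add: M.finsum_insert M.finsum_empty smult_closed M.a_assoc)

lemma basis3_span:
  assumes "x \<in> carrier M"
  shows "\<exists>p\<in>carrier R. \<exists>q\<in>carrier R. \<exists>r\<in>carrier R. x = lin3 M u v w p q r"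
proof -
  obtain c where c: "c \<in> {u, v, w} \<rightarrow>\<^sub>E carrier R" "x = (\<Oplus>\<^bsub>M\<^esub>x\<in>{u, v, w}. c x \<odot>\<^bsub>M\<^esub> x)"
    using finite_basis_unique_coefficients[OF free _ assms] by auto
  have "x = lin3 M u v w (c u) (c v) (c w)"
    using c finsum_basis3[of c] by auto
  moreover have "c u \<in> carrier R" "c v \<in> carrier R" "c w \<in> carrier R"
    using c by auto
  ultimately show ?thesis by blast
qed

lemma basis3_carrier:
  "carrier M = {lin3 M u v w p q r | p q r. p \<in> carrier R \<and> q \<in> carrier R \<and> r \<in> carrier R}"
proof (intro equalityI subsetI)
  fix x assume "x \<in> carrier M"
  then show "x \<in> {lin3 M u v w p q r | p q r. p \<in> carrier R \<and> q \<in> carrier R \<and> r \<in> carrier R}"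
    using basis3_span by blast
next
  fix x assume "x \<in> {lin3 M u v w p q r | p q r. p \<in> carrier R \<and> q \<in> carrier R \<and> r \<in> carrier R}"
  then obtain p q r where "x = lin3 M u v w p q r" "p \<in> carrier R" "q \<in> carrier R" "r \<in> carrier R"
    by blast
  then show "x \<in> carrier M"
    using basis3_closed by (simp add: smult_closed)
qed

lemma basis3_independent:
  assumes "lin3 M u v w p q r = lin3 M u v w p' q' r'"
    and R: "p \<in> carrier R" "q \<in> carrier R" "r \<in> carrier R"
      "p' \<in> carrier R" "q' \<in> carrier R" "r' \<in> carrier R"
  shows "p = p' \<and> q = q' \<and> r = r'"
proof -
  define c where "c = (\<lambda>x\<in>{u, v, w}. if x = u then p else if x = v then q else r)"
  define c' where "c' = (\<lambda>x\<in>{u, v, w}. if x = u then p' else if x = v then q' else r')"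
  have cc: "c \<in> {u, v, w} \<rightarrow>\<^sub>E carrier R" "c' \<in> {u, v, w} \<rightarrow>\<^sub>E carrier R"
    using R by (auto simp: c_def c'_def)
  have val: "c u = p" "c v = q" "c w = r" "c' u = p'" "c' v = q'" "c' w = r'"
    using basis3_distinct by (auto simp: c_def c'_def)
  have "(\<Oplus>\<^bsub>M\<^esub>x\<in>{u, v, w}. c x \<odot>\<^bsub>M\<^esub> x) = lin3 M u v w p q r"
    "(\<Oplus>\<^bsub>M\<^esub>x\<in>{u, v, w}. c' x \<odot>\<^bsub>M\<^esub> x) = lin3 M u v w p q r"
    using cc finsum_basis3[of c] finsum_basis3[of c'] val assms(1) by (auto simp: PiE_iff Pi_iff)
  moreover have "lin3 M u v w p q r \<in> carrier M"
    using R basis3_closed by (intro M.a_closed smult_closed)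
  moreover note finite_basis_unique_coefficients[OF free _ this]
  ultimately have "c = c'"
    using cc by auto
  then show ?thesis using val by metis
qed

lemma basis3_hom_extension:
  assumes "left_module R N" "u' \<in> carrier N" "v' \<in> carrier N" "w' \<in> carrier N"
  shows "\<exists>h\<in>left_module_hom R M N. h u = u' \<and> h v = v' \<and> h w = w'"
  using finite_basis_hom_extension[OF free _ assms(1), of "\<lambda>x. if x = u then u' else if x = v then v' else w'"]
    basis3_distinct assms(2-4) by auto

lemma left_module_hom_lin3:
  assumes "h \<in> left_module_hom R M N" "p \<in> carrier R" "q \<in> carrier R" "r \<in> carrier R"
  shows "h (lin3 M u v w p q r) = lin3 N (h u) (h v) (h w) p q r"
  using assms basis3_closed by (simp add: left_module_hom_def smult_closed)

end

context
  fixes R :: "('r, 'x) ring_scheme" and M :: "('r, 'm, 'y) module_scheme" and u :: 'm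
  assumes free: "free_with_basis R M {u}"
begin

interpretation left_module R M
  using free by (simp add: free_with_basis_def)

lemma basis1_closed: "u \<in> carrier M"
  using basis_closed[OF free] by auto

lemma finsum_basis1:
  assumes "c u \<in> carrier R"
  shows "(\<Oplus>\<^bsub>M\<^esub>x\<in>{u}. c x \<odot>\<^bsub>M\<^esub> x) = c u \<odot>\<^bsub>M\<^esub> u"
  using assms basis1_closed by (simp add: M.finsum_insert M.finsum_empty smult_closed)

lemma basis1_span:
  assumes "x \<in> carrier M"
  shows "\<exists>p\<in>carrier R. x = p \<odot>\<^bsub>M\<^esub> u"
proof -
  obtain c where c: "c \<in> {u} \<rightarrow>\<^sub>E carrier R" "x = (\<Oplus>\<^bsub>M\<^esub>x\<in>{u}. c x \<odot>\<^bsub>M\<^esub> x)"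
    using finite_basis_unique_coefficients[OF free _ assms] by auto
  have "c u \<in> carrier R"
    using c by auto
  then show ?thesis
    using c finsum_basis1[of c] by auto
qed

lemma basis1_independent:
  assumes "p \<odot>\<^bsub>M\<^esub> u = p' \<odot>\<^bsub>M\<^esub> u" "p \<in> carrier R" "p' \<in> carrier R"
  shows "p = p'"
proof -
  define c where "c = (\<lambda>x\<in>{u}. p)"
  define c' where "c' = (\<lambda>x\<in>{u}. p')"
  have cc: "c \<in> {u} \<rightarrow>\<^sub>E carrier R" "c' \<in> {u} \<rightarrow>\<^sub>E carrier R" and val: "c u = p" "c' u = p'"
    using assms by (auto simp: c_def c'_def)
  have "(\<Oplus>\<^bsub>M\<^esub>x\<in>{u}. c x \<odot>\<^bsub>M\<^esub> x) = p \<odot>\<^bsub>M\<^esub> u"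
    "(\<Oplus>\<^bsub>M\<^esub>x\<in>{u}. c' x \<odot>\<^bsub>M\<^esub> x) = p \<odot>\<^bsub>M\<^esub> u"
    using finsum_basis1[of c] finsum_basis1[of c'] val assms by auto
  moreover have "p \<odot>\<^bsub>M\<^esub> u \<in> carrier M"
    using assms basis1_closed by (intro smult_closed)
  moreover note finite_basis_unique_coefficients[OF free _ this]
  ultimately have "c = c'"
    using cc by auto
  then show ?thesis using val by metis
qed

lemma basis1_hom_extension:
  assumes "left_module R N" "u' \<in> carrier N"
  shows "\<exists>h\<in>left_module_hom R M N. h u = u'"
  using finite_basis_hom_extension[OF free _ assms(1), of "\<lambda>x. u'"] assms(2) by auto

end

section \<open>Finitely supported functions and the group ring\<close>

text \<open>A nonzero invariant element has a finite nonempty support carried onto itself by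
  \<open>\<sigma>\<close>; the orbit of a support point then repeats, which is a cycle.\<close>

lemma frag_extend_invariant_eq_0:
  assumes inv: "frag_extend (\<lambda>x. frag_of (\<sigma> x)) r = r"
    and no_cycles: "\<And>x n. n > 0 \<Longrightarrow> (\<sigma> ^^ n) x \<noteq> x"
  shows "r = 0"
proof (rule ccontr)
  assume "r \<noteq> 0"
  let ?K = "Poly_Mapping.keys r"
  \<comment> \<open>Every support point of a pushforward is the image of a support point. A finite
    set contained in its own image equals it, by cardinality.\<close>
  have "?K \<subseteq> \<sigma> ` ?K"
    using keys_frag_extend[of "\<lambda>x. frag_of (\<sigma> x)" r] by (auto simp: inv keys_frag_of)
  then have K: "\<sigma> ` ?K = ?K"
    by (metis card_image_le card_seteq finite_imageI finite_keys)
  then have inj: "inj_on \<sigma> ?K"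
    by (simp add: eq_card_imp_inj_on)
  obtain x where "x \<in> ?K"
    using \<open>r \<noteq> 0\<close> by (meson ex_in_conv keys_eq_empty)
  then have iter: "(\<sigma> ^^ n) x \<in> ?K" for n
    by (induction n) (use K in auto)
  \<comment> \<open>An injective orbit would be an infinite subset of the finite support.\<close>
  then have "\<not> inj (\<lambda>n. (\<sigma> ^^ n) x)"
    using finite_subset[of "range (\<lambda>n. (\<sigma> ^^ n) x)" ?K] finite_imageD[of "\<lambda>n. (\<sigma> ^^ n) x" UNIV]
    by auto
  then obtain i j where ij: "i < j" "(\<sigma> ^^ i) x = (\<sigma> ^^ j) x"
    by (metis injI linorder_neqE_nat)
  have "(\<sigma> ^^ (j - i)) ((\<sigma> ^^ i) x) = (\<sigma> ^^ (j - i + i)) x"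
    by (simp only: funpow_add o_apply)
  with no_cycles[of "j - i" "(\<sigma> ^^ i) x"] ij show False by simp
qed

text \<open>A device for computing kernels of pushforwards: \<open>s\<close> picks a representative
  for each value of \<open>f\<close>, and modulo the subgroup \<open>I\<close> every
  \<open>g\<close> agrees with \<open>s (f g)\<close>. Hence \<open>r\<close> is congruent to the
  image under \<open>s\<close> of its pushforward along \<open>f\<close>, which is zero.\<close>

lemma frag_in_subgroup:
  assumes "0 \<in> I" and diff: "\<And>u v. u \<in> I \<Longrightarrow> v \<in> I \<Longrightarrow> u - v \<in> I"
    and lift: "\<And>g. frag_of g - frag_of (s (f g)) \<in> I"
    and "frag_extend (\<lambda>g. frag_of (f g)) r = 0"
  shows "r \<in> I"
proof -
  have "r - frag_extend (\<lambda>x. frag_of (s x)) (frag_extend (\<lambda>g. frag_of (f g)) r) \<in> I"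
    using subset_UNIV[of "Poly_Mapping.keys r"]
  proof (induction r rule: frag_induction)
    case (diff u v)
    let ?p = "\<lambda>r. frag_extend (\<lambda>x. frag_of (s x)) (frag_extend (\<lambda>g. frag_of (f g)) r)"
    have "(u - ?p u) - (v - ?p v) \<in> I"
      by (rule assms(2)[OF diff])
    then show ?case by (simp add: frag_extend_diff algebra_simps)
  qed (use assms in auto)
  with assms(4) show ?thesis by simp
qed

text \<open>The bound \<open>p \<le> q + 1\<close> admits the empty interval with
  \<open>q = p - 1\<close>, where both sides vanish; for smaller \<open>q\<close> the sum is still
  empty but the right side need not be zero.\<close>

lemma sum_int_telescope:
  fixes f :: "int \<Rightarrow> 'a :: ab_group_add"
  assumes "p \<le> q + 1"
  shows "(\<Sum>k\<in>{p..q}. f (k + 1) - f k) = f (q + 1) - f p"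
proof -
  have "(\<Sum>k\<in>{p..q' - 1}. f (k + 1) - f k) = f q' - f p" if "p \<le> q'" for q'
    using that
  proof (induction q' rule: int_ge_induct)
    case (step i)
    then have "{p..i + 1 - 1} = insert i {p..i - 1}" by auto
    with step show ?case by simp
  qed simp
  from this[of "q + 1"] assms show ?thesis by simp
qed

section \<open>Arithmetic in the group ring of the torus bundle group\<close>

locale torus_bundle =
  fixes \<theta> :: "int^2^2"
  assumes invertible_theta: "invertible \<theta>"
begin

abbreviation G where "G \<equiv> torus_bundle_group \<theta>"

abbreviation mul :: "((int \<times> int) \<times> int \<Rightarrow>\<^sub>0 int) \<Rightarrow> _ \<Rightarrow> _" (infixl "\<star>" 70)
  where "u \<star> v \<equiv> u \<otimes>\<^bsub>torus_bundle_ring \<theta>\<^esub> v"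

interpretation G: group G
  by (rule group_torus_bundle_group[OF invertible_theta])

interpretation R: ring "torus_bundle_ring \<theta>"
  by (rule ring_group_ring[OF G.group_axioms])

text \<open>The action of the \<open>k\<close>-th power of \<open>t\<close>. Its additivity and
  composition laws are obtained below from associativity in \<open>G\<close>, applied to elements
  such as \<open>(0, k)\<close> and \<open>(x, 0)\<close>, instead of from powers in the
  automorphism group.\<close>

definition power_act :: "int \<Rightarrow> int \<times> int \<Rightarrow> int \<times> int"
  where "power_act k = act \<theta> [^]\<^bsub>AutoGroup Z2\<^esub> k"

lemma carrier_G [simp]: "carrier G = UNIV"
  by (simp add: torus_bundle_group_def semidirect_product_def)

lemma carrier_R [simp]: "carrier (torus_bundle_ring \<theta>) = UNIV"
  by (simp add: group_ring_def)

lemma add_R [simp]: "u \<oplus>\<^bsub>torus_bundle_ring \<theta>\<^esub> v = u + v"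
  by (simp add: group_ring_def)

lemma zero_R [simp]: "\<zero>\<^bsub>torus_bundle_ring \<theta>\<^esub> = 0"
  by (simp add: group_ring_def)

lemma mult_G [simp]: "(x, k) \<otimes>\<^bsub>G\<^esub> (y, l) = (x + power_act k y, k + l)"
  by (cases x; cases "power_act k y")
    (simp add: torus_bundle_group_def semidirect_product_def power_act_def)

lemma one_G: "\<one>\<^bsub>G\<^esub> = (0, 0)"
  by (simp add: torus_bundle_group_def semidirect_product_def zero_prod_def)

lemma power_act_add: "power_act k (x + y) = power_act k x + power_act k y"
  using G.m_assoc[of "(0, k)" "(x, 0)" "(y, 0)"] G.l_one[of "(y, 0)"] 
  by (simp add: one_G)

lemma power_act_zero [simp]: "power_act k 0 = 0"
  using power_act_add[of k 0 0] by simp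

lemma power_act_0 [simp]: "power_act 0 x = x"
  using G.l_one[of "(x, 0)"] by (simp add: one_G)

lemma power_act_power_act: "power_act k (power_act l x) = power_act (k + l) x"
  using G.m_assoc[of "(0, k)" "(0, l)" "(x, 0)"] by simp

lemma power_act_1 [simp]: "power_act 1 = act \<theta>"
  using group.int_pow_1[OF group.AutoGroup[OF group_Z2] act_auto[OF invertible_theta]]
  by (simp add: power_act_def)

lemma mul_frag_of: "r \<star> frag_of h = frag_extend (\<lambda>g. frag_of (g \<otimes>\<^bsub>G\<^esub> h)) r"
  by (simp add: group_ring_def)

lemma frag_of_mul: "frag_of g \<star> frag_of h = frag_of (g \<otimes>\<^bsub>G\<^esub> h)"
  by (simp add: mul_frag_of)

lemma mul_assoc: "u \<star> v \<star> w = u \<star> (v \<star> w)"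
  using R.m_assoc by simp

lemma one_R: "\<one>\<^bsub>torus_bundle_ring \<theta>\<^esub> = elt 0 0 0"
  by (simp add: group_ring_def one_G zero_prod_def)

lemma one_mul [simp]: "elt 0 0 0 \<star> u = u" "u \<star> elt 0 0 0 = u"
  using R.l_one[of u] R.r_one[of u] by (simp_all add: one_R)

lemma mul_distribs:
  "(u + v) \<star> w = u \<star> w + v \<star> w" "(u - v) \<star> w = u \<star> w - v \<star> w" "(- u) \<star> w = - (u \<star> w)"
  "u \<star> (v + w) = u \<star> v + u \<star> w" "u \<star> (v - w) = u \<star> v - u \<star> w" "u \<star> (- w) = - (u \<star> w)"
proof -
  show add: "u \<star> (v + w) = u \<star> v + u \<star> w" for u v w
    using R.r_distr[of v w u] by simp
  show diff: "u \<star> (v - w) = u \<star> v - u \<star> w" for u v w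
    using add[of u "v - w" w] by simp
  show "u \<star> (- w) = - (u \<star> w)"
    using diff[of u 0 w] add[of u 0 0] by simp
  show add: "(u + v) \<star> w = u \<star> w + v \<star> w" for u v w
    using R.l_distr[of u v w] by simp
  show diff: "(u - v) \<star> w = u \<star> w - v \<star> w" for u v w
    using add[of "u - v" v w] by simp
  show "(- u) \<star> w = - (u \<star> w)"
    using diff[of 0 u w] add[of 0 0 w] by simp
qed

lemma mul_zero [simp]: "u \<star> 0 = 0" "0 \<star> u = 0"
  using R.r_null[of u] R.l_null[of u] by simp_all

lemma sum_mul: "(\<Sum>i\<in>I. f i) \<star> w = (\<Sum>i\<in>I. f i \<star> w)"
  by (induction I rule: infinite_finite_induct) (simp_all add: mul_distribs)

lemma funpow_right_mult: "((\<lambda>g. g \<otimes>\<^bsub>G\<^esub> h) ^^ n) g = g \<otimes>\<^bsub>G\<^esub> (h [^]\<^bsub>G\<^esub> n)"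
  by (induction n) (simp_all add: G.m_assoc)

lemma pow_Z2: "((m, n), 0) [^]\<^bsub>G\<^esub> (k::nat) = ((int k * m, int k * n), 0)"
  by (induction k) (simp_all add: one_G zero_prod_def algebra_simps)

text \<open>Annihilation by \<open>h - 1\<close> from the right says that \<open>r\<close> is
  invariant under right translation by \<open>h\<close>, and a nontrivial \<open>h\<close> in the
  lattice has infinite order. This is the cancellation behind all identities for the
  coefficients.\<close>

lemma mul_Z2_minus_one_cancel:
  assumes "r \<star> (elt m n 0 - elt 0 0 0) = 0" "(m, n) \<noteq> (0, 0)"
  shows "r = 0"
proof (rule frag_extend_invariant_eq_0)
  show "frag_extend (\<lambda>g. frag_of (g \<otimes>\<^bsub>G\<^esub> ((m, n), 0))) r = r"
    using assms(1) by (simp add: mul_distribs flip: mul_frag_of)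
  fix g :: "(int \<times> int) \<times> int" and k :: nat assume k: "k > 0"
  \<comment> \<open>A fixed point of the iterated translation would make a positive power of a
    nonzero lattice element trivial.\<close>
  have "g \<otimes>\<^bsub>G\<^esub> ((m, n), 0) [^]\<^bsub>G\<^esub> k \<noteq> g"
    using G.r_cancel_one[of g "((m, n), 0) [^]\<^bsub>G\<^esub> k"] k assms(2) 
    by (auto simp: pow_Z2 one_G zero_prod_def simp del: mult_G)
  then show "((\<lambda>g. g \<otimes>\<^bsub>G\<^esub> ((m, n), 0)) ^^ k) g \<noteq> g"
    unfolding funpow_right_mult .
qed


section \<open>Left ideals generated by \<open>\<Delta>a\<close>, \<open>\<Delta>b\<close> and
  \<open>\<Delta>t\<close>\<close>

abbreviation \<Delta>a where "\<Delta>a \<equiv> elt 1 0 0 - elt 0 0 0"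
abbreviation \<Delta>b where "\<Delta>b \<equiv> elt 0 1 0 - elt 0 0 0"
abbreviation \<Delta>t where "\<Delta>t \<equiv> elt 0 0 1 - elt 0 0 0"

text \<open>The element \<open>t\<^sup>k a\<^sup>m b\<^sup>n\<close>; right multiplication by \<open>a\<close> and \<open>b\<close> acts on the exponents by translation.\<close>

definition tab :: "int \<Rightarrow> int \<Rightarrow> int \<Rightarrow> (int \<times> int) \<times> int"
  where "tab k m n = (power_act k (m, n), k)"

lemma tab_cases: obtains m n where "g = tab (snd g) m n"
proof
  let ?p = "power_act (- snd g) (fst g)"
  show "g = tab (snd g) (fst ?p) (snd ?p)"
    by (simp add: tab_def power_act_power_act)
qed

lemma tab_mult: "tab k m n \<otimes>\<^bsub>G\<^esub> ((m', n'), 0) = tab k (m + m') (n + n')"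
  by (simp add: tab_def flip: power_act_add)

lemma snd_tab [simp]: "snd (tab k m n) = k"
  by (simp add: tab_def)

lemma tab_inverse: "power_act (- k) (fst (tab k m n)) = (m, n)"
  by (simp add: tab_def power_act_power_act)

text \<open>Consecutive members of the chain differ by
  \<open>frag_of (c k) \<star> (frag_of h - elt 0 0 0)\<close>, so all differences accumulate in the
  left ideal. The induction runs in both directions because exponents may be negative.\<close>

lemma int_chain_in_left_ideal:
  assumes "\<And>k::int. frag_of (c k \<otimes>\<^bsub>G\<^esub> h) = frag_of (c (k + 1))"
  shows "\<exists>q. frag_of (c k) - frag_of (c 0) = q \<star> (frag_of h - elt 0 0 0)"
proof (induction k rule: int_induct[where k = 0])
  case base
  show ?case by (rule exI[of _ 0]) simp
next
  case (step1 k)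
  then obtain q where "frag_of (c k) - frag_of (c 0) = q \<star> (frag_of h - elt 0 0 0)" by blast
  moreover have "frag_of (c k) \<star> (frag_of h - elt 0 0 0) = frag_of (c (k + 1)) - frag_of (c k)"
    by (simp add: mul_distribs frag_of_mul assms del: mult_G)
  ultimately have "(q + frag_of (c k)) \<star> (frag_of h - elt 0 0 0)
      = (frag_of (c k) - frag_of (c 0)) + (frag_of (c (k + 1)) - frag_of (c k))"
    by (simp only: mul_distribs(1))
  then have "frag_of (c (k + 1)) - frag_of (c 0) = (q + frag_of (c k)) \<star> (frag_of h - elt 0 0 0)"
    by simp
  then show ?case by blast
next
  case (step2 k)
  then obtain q where "frag_of (c k) - frag_of (c 0) = q \<star> (frag_of h - elt 0 0 0)" by blast
  moreover have "frag_of (c (k - 1)) \<star> (frag_of h - elt 0 0 0) = frag_of (c k) - frag_of (c (k - 1))"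
    using assms[of "k - 1"] by (simp add: mul_distribs frag_of_mul del: mult_G)
  ultimately have "(q - frag_of (c (k - 1))) \<star> (frag_of h - elt 0 0 0)
      = (frag_of (c k) - frag_of (c 0)) - (frag_of (c k) - frag_of (c (k - 1)))"
    by (simp only: mul_distribs(2))
  then have "frag_of (c (k - 1)) - frag_of (c 0) = (q - frag_of (c (k - 1))) \<star> (frag_of h - elt 0 0 0)"
    by simp
  then show ?case by blast
qed

lemma tab_minus_tab_in_left_ideal_b:
  "\<exists>q. frag_of (tab k m n) - frag_of (tab k m 0) = q \<star> \<Delta>b"
  by (rule int_chain_in_left_ideal) (simp add: tab_mult)

lemma tab_minus_tab_in_left_ideal_a:
  "\<exists>q. frag_of (tab k m 0) - frag_of (tab k 0 0) = q \<star> \<Delta>a"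
  by (rule int_chain_in_left_ideal[where c = "\<lambda>m. tab k m 0"]) (simp add: tab_mult)

lemma tab_minus_one_in_left_ideal_t:
  "\<exists>q. frag_of (tab k 0 0) - elt 0 0 0 = q \<star> \<Delta>t"
proof -
  have tab: "tab k 0 0 = (0, k)" for k
    by (simp add: tab_def flip: zero_prod_def)
  \<comment> \<open>The chain consists of the powers of \<open>t\<close>, each obtained from its
    predecessor by right multiplication by \<open>t\<close>.\<close>
  show ?thesis
    using int_chain_in_left_ideal[of "\<lambda>k. (0, k)" "((0, 0), 1)" k]
    by (simp add: tab flip: zero_prod_def)
qed

text \<open>Pushing forward along \<open>snd\<close> maps onto Laurent polynomials in
  \<open>t\<close>. Modulo the left ideal every group element equals the power of \<open>t\<close>
  with the same second component, so the kernel lies in the ideal: this identifies the Koszul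
  homology in degree 0.\<close>

lemma in_left_ideal_ab:
  assumes "frag_extend (\<lambda>g. frag_of (snd g)) r = 0"
  shows "\<exists>p q. r = p \<star> \<Delta>a + q \<star> \<Delta>b"
proof -
  let ?I = "{p \<star> \<Delta>a + q \<star> \<Delta>b | p q. True}"
  have "r \<in> ?I"
  proof (rule frag_in_subgroup[OF _ _ _ assms])
    show "0 \<in> ?I" by (intro CollectI exI[of _ 0]) simp
    show "u - v \<in> ?I" if "u \<in> ?I" "v \<in> ?I" for u v
    proof -
      obtain p q p' q' where "u = p \<star> \<Delta>a + q \<star> \<Delta>b" "v = p' \<star> \<Delta>a + q' \<star> \<Delta>b"
        using \<open>u \<in> ?I\<close> \<open>v \<in> ?I\<close> by blast
      then have "u - v = (p - p') \<star> \<Delta>a + (q - q') \<star> \<Delta>b"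
        unfolding mul_distribs(2) by simp
      then show ?thesis by blast
    qed
    show "frag_of g - frag_of (tab (snd g) 0 0) \<in> ?I" for g
    proof -
      obtain m n where g: "g = tab (snd g) m n" by (rule tab_cases)
      let ?k = "snd g"
      \<comment> \<open>First the exponent of \<open>b\<close> is removed, then that of
        \<open>a\<close>.\<close>
      obtain p q where pq: "frag_of (tab ?k m 0) - frag_of (tab ?k 0 0) = p \<star> \<Delta>a"
        "frag_of (tab ?k m n) - frag_of (tab ?k m 0) = q \<star> \<Delta>b"
        using tab_minus_tab_in_left_ideal_a tab_minus_tab_in_left_ideal_b by meson
      have "p \<star> \<Delta>a + q \<star> \<Delta>b = frag_of (tab ?k m n) - frag_of (tab ?k 0 0)"
        unfolding pq[symmetric] by simp
      then show ?thesis using g by (metis (mono_tags, lifting) mem_Collect_eq)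
    qed
  qed
  then show ?thesis by blast
qed

text \<open>The same reduction with one further stage: modulo the three generators the remaining
  power of \<open>t\<close> becomes 1, so an element is congruent to its coefficient sum. This is
  exactness at \<open>P\<^sub>0\<close>.\<close>

lemma augmentation_ideal:
  assumes "augmentation r = 0"
  shows "\<exists>p q s. r = p \<star> \<Delta>a + q \<star> \<Delta>b + s \<star> \<Delta>t"
proof -
  let ?I = "{p \<star> \<Delta>a + q \<star> \<Delta>b + s \<star> \<Delta>t | p q s. True}"
  have "r \<in> ?I"
  proof (rule frag_in_subgroup)
    show "frag_extend (\<lambda>g. frag_of ()) r = 0"
      using assms by (intro poly_mapping_eqI) (simp add: augmentation_lookup)
    show "0 \<in> ?I" by (intro CollectI exI[of _ 0]) simp
    show "u - v \<in> ?I" if "u \<in> ?I" "v \<in> ?I" for u v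
    proof -
      obtain p q s p' q' s' where "u = p \<star> \<Delta>a + q \<star> \<Delta>b + s \<star> \<Delta>t" "v = p' \<star> \<Delta>a + q' \<star> \<Delta>b + s' \<star> \<Delta>t"
        using \<open>u \<in> ?I\<close> \<open>v \<in> ?I\<close> by blast
      then have "u - v = (p - p') \<star> \<Delta>a + (q - q') \<star> \<Delta>b + (s - s') \<star> \<Delta>t"
        unfolding mul_distribs(2) by simp
      then show ?thesis by blast
    qed
    show "frag_of g - elt 0 0 0 \<in> ?I" for g
    proof -
      obtain m n where g: "g = tab (snd g) m n" by (rule tab_cases)
      let ?k = "snd g"
      obtain p q s where pqs: "frag_of (tab ?k m 0) - frag_of (tab ?k 0 0) = p \<star> \<Delta>a"
        "frag_of (tab ?k m n) - frag_of (tab ?k m 0) = q \<star> \<Delta>b"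
        "frag_of (tab ?k 0 0) - elt 0 0 0 = s \<star> \<Delta>t"
        using tab_minus_tab_in_left_ideal_a tab_minus_tab_in_left_ideal_b tab_minus_one_in_left_ideal_t
        by meson
      have "p \<star> \<Delta>a + q \<star> \<Delta>b + s \<star> \<Delta>t = frag_of (tab ?k m n) - elt 0 0 0"
        unfolding pqs[symmetric] by simp
      then show ?thesis using g by (metis (mono_tags, lifting) mem_Collect_eq)
    qed
  qed
  then show ?thesis by blast
qed

section \<open>Koszul exactness and the action of \<open>t - 1\<close> in degree 0\<close>

lemma frag_extend_mul_frag_of:
  "frag_extend (\<lambda>g. frag_of (f g)) (r \<star> frag_of h) = frag_extend (\<lambda>g. frag_of (f (g \<otimes>\<^bsub>G\<^esub> h))) r"
  by (simp add: mul_frag_of frag_extend_comp)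

text \<open>If \<open>f\<close> carries right translation by \<open>h\<close> to
  \<open>\<sigma>\<close>, then multiplication by \<open>h - 1\<close> becomes
  \<open>\<sigma>\<close> minus the identity. It dies when \<open>\<sigma>\<close> is the identity
  and is injective when \<open>\<sigma>\<close> has no cycles.\<close>

lemma frag_extend_mul_minus_one:
  assumes "\<And>g. f (g \<otimes>\<^bsub>G\<^esub> h) = \<sigma> (f g)"
  shows "frag_extend (\<lambda>g. frag_of (f g)) (r \<star> (frag_of h - elt 0 0 0)) =
    frag_extend (\<lambda>x. frag_of (\<sigma> x)) (frag_extend (\<lambda>g. frag_of (f g)) r)
    - frag_extend (\<lambda>g. frag_of (f g)) r"
  by (simp add: mul_distribs frag_extend_diff frag_extend_mul_frag_of frag_extend_comp assms del: mult_G)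

lemma funpow_int_translation: "((\<lambda>k. k + 1 :: int) ^^ n) k = k + int n"
  by (induction n) auto

text \<open>Injectivity of \<open>t - 1\<close> on degree-0 homology: after projection to the
  exponent of \<open>t\<close> only the term with \<open>s\<close> survives, so the image of
  \<open>s\<close> is invariant under translation and vanishes.\<close>

lemma in_left_ideal_ab_if_mul_t:
  assumes "p \<star> \<Delta>a + q \<star> \<Delta>b + s \<star> \<Delta>t = 0"
  shows "\<exists>p' q'. s = p' \<star> \<Delta>a + q' \<star> \<Delta>b"
proof (rule in_left_ideal_ab)
  let ?\<pi> = "frag_extend (\<lambda>g :: (int \<times> int) \<times> int. frag_of (snd g))"
  have ab: "snd (g \<otimes>\<^bsub>G\<^esub> ((m, n), 0)) = snd g" for g m n
    by (cases g) simp
  have t: "snd (g \<otimes>\<^bsub>G\<^esub> ((0, 0), 1)) = snd g + 1" for g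
    by (cases g) simp
  have "?\<pi> (p \<star> \<Delta>a) = 0" "?\<pi> (q \<star> \<Delta>b) = 0"
    \<comment> \<open>For the identity as \<open>\<sigma>\<close>, the pushforward along it is the
      identity by \<open>frag_expansion\<close>, and the two terms cancel.\<close>
    using frag_expansion[of "?\<pi> p"] frag_expansion[of "?\<pi> q"]
    by (simp_all only: frag_extend_mul_minus_one[where f = snd and \<sigma> = "\<lambda>k. k", OF ab] diff_self)
  then have "frag_extend (\<lambda>k. frag_of (k + 1)) (?\<pi> s) - ?\<pi> s = 0"
    using arg_cong[OF assms, of ?\<pi>]
    by (simp add: frag_extend_add frag_extend_mul_minus_one[where f = snd and \<sigma> = "\<lambda>k. k + 1", OF t])
  then show "?\<pi> s = 0"
    by (intro frag_extend_invariant_eq_0[where \<sigma> = "\<lambda>k. k + 1"]) (auto simp: funpow_int_translation)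
qed

text \<open>Forgetting the exponent of \<open>b\<close> kills the multiple of
  \<open>\<Delta>b\<close> and turns \<open>\<Delta>a\<close> into an injective difference operator,
  so \<open>r\<close> is a left multiple of \<open>\<Delta>b\<close>. Commuting
  \<open>\<Delta>a\<close> with \<open>\<Delta>b\<close> and cancelling \<open>\<Delta>b\<close>
  then determines \<open>s\<close>.\<close>

lemma Koszul_exact:
  assumes eq: "r \<star> \<Delta>a + s \<star> \<Delta>b = 0"
  shows "\<exists>q. r = q \<star> (elt 0 0 0 - elt 0 1 0) \<and> s = q \<star> \<Delta>a"
proof -
  \<comment> \<open>On \<open>tab k m n\<close> the value is \<open>(m, k)\<close>;
    \<open>f_tab\<close> confirms this.\<close>
  define f where "f g = (fst (power_act (- snd g) (fst g)), snd g)" for g :: "(int \<times> int) \<times> int"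
  let ?\<pi> = "frag_extend (\<lambda>g. frag_of (f g))"
  have f_tab: "f (tab k m n) = (m, k)" for k m n
    by (simp add: f_def tab_inverse)
  have f_mult: "f (g \<otimes>\<^bsub>G\<^esub> ((m, n), 0)) = (fst (f g) + m, snd (f g))" for g m n
  proof -
    obtain m' n' where "g = tab (snd g) m' n'" by (rule tab_cases)
    moreover have "f (tab k m' n' \<otimes>\<^bsub>G\<^esub> ((m, n), 0)) = (fst (f (tab k m' n')) + m, snd (f (tab k m' n')))" for k
      by (simp only: tab_mult f_tab fst_conv snd_conv)
    ultimately show ?thesis by metis
  qed
  have "?\<pi> (s \<star> \<Delta>b) = 0"
    using frag_expansion[of "?\<pi> s"]
    \<comment> \<open>The \<open>+ 0\<close> gives \<open>\<sigma>\<close> the literal shape of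
      \<open>f_mult\<close> with \<open>m = 0\<close>.\<close>
    by (simp add: frag_extend_mul_minus_one[where f = f and \<sigma> = "\<lambda>x. (fst x + 0, snd x)", OF f_mult]
        del: mult_G)
  then have "frag_extend (\<lambda>x. frag_of (fst x + 1, snd x)) (?\<pi> r) - ?\<pi> r = 0"
    using arg_cong[OF eq, of ?\<pi>]
    by (simp add: frag_extend_add frag_extend_mul_minus_one[where f = f and \<sigma> = "\<lambda>x. (fst x + 1, snd x)", OF f_mult])
  moreover have "((\<lambda>x. (fst x + 1, snd x)) ^^ n) x = (fst x + int n, snd x)" for n and x :: "int \<times> int"
    by (induction n) auto
  ultimately have "?\<pi> r = 0"
    by (intro frag_extend_invariant_eq_0[where \<sigma> = "\<lambda>x. (fst x + 1, snd x)"]) (auto simp: prod_eq_iff)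
  have "r \<in> {q \<star> \<Delta>b | q. True}"
  proof (rule frag_in_subgroup[OF _ _ _ \<open>?\<pi> r = 0\<close>])
    show "0 \<in> {q \<star> \<Delta>b | q. True}" by (intro CollectI exI[of _ 0]) simp
    show "u - v \<in> {q \<star> \<Delta>b | q. True}" if "u \<in> {q \<star> \<Delta>b | q. True}" "v \<in> {q \<star> \<Delta>b | q. True}" for u v
      using that by (auto simp flip: mul_distribs(2))
    \<comment> \<open>The representative has the same exponents of \<open>t\<close> and
      \<open>a\<close> as \<open>g\<close>, and exponent 0 of \<open>b\<close>.\<close>
    show "frag_of g - frag_of (tab (snd (f g)) (fst (f g)) 0) \<in> {q \<star> \<Delta>b | q. True}" for g
    proof -
      obtain m n where g: "g = tab (snd g) m n" by (rule tab_cases)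
      then have "f g = (m, snd g)" by (metis f_tab)
      then show ?thesis using tab_minus_tab_in_left_ideal_b[of "snd g" m n] g by auto
    qed
  qed
  then obtain q where q: "r = q \<star> \<Delta>b" by blast
  have comm: "\<Delta>a \<star> \<Delta>b = \<Delta>b \<star> \<Delta>a"
    by (simp add: mul_distribs frag_of_mul)
  have "(q \<star> \<Delta>a + s) \<star> \<Delta>b = 0"
    using eq unfolding q mul_distribs(1) mul_assoc comm .
  then have "q \<star> \<Delta>a + s = 0"
    by (rule mul_Z2_minus_one_cancel) simp
  then have "s = (- q) \<star> \<Delta>a"
    by (simp add: mul_distribs(3) eq_neg_iff_add_eq_0 add.commute)
  moreover have "r = (- q) \<star> (elt 0 0 0 - elt 0 1 0)"
    unfolding q by (simp add: mul_distribs)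
  ultimately show ?thesis by blast
qed

end

section \<open>The coefficients\<close>

text \<open>If the comparisons were strict in opposite directions, the larger product would exceed
  the smaller by at least \<open>p + s + 1\<close> or \<open>r + q + 1\<close>, more than 1. Hence
  the comparison conditions in the table miss no case.\<close>

lemma unimodular_comparable:
  fixes p q r s :: int
  assumes "p > 0" "q > 0" "r > 0" "s > 0" "\<bar>p * s - r * q\<bar> = 1"
  shows "p \<le> r \<and> q \<le> s \<or> r \<le> p \<and> s \<le> q"
proof (rule ccontr)
  assume "\<not> ?thesis"
  then consider "p + 1 \<le> r" "s + 1 \<le> q" | "r + 1 \<le> p" "q + 1 \<le> s" by linarith
  then show False
  proof cases
    case 1
    then have "(p + 1) * (s + 1) \<le> r * q" using assms by (intro mult_mono) auto
    with assms show False by (simp add: algebra_simps)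
  next
    case 2
    then have "(r + 1) * (q + 1) \<le> p * s" using assms by (intro mult_mono) auto
    with assms show False by (simp add: algebra_simps)
  qed
qed

text \<open>A zero entry forces both factors of the other diagonal product to be units, which gives
  the rows with singletons. Otherwise the two products have equal signs, leaving eight sign
  patterns, and the absolute values are comparable.\<close>

lemma E_table_total:
  assumes det: "\<bar>M1 * N2 - M2 * N1\<bar> = 1"
  shows "\<exists>I1 J1 I2 J2. E_table M1 N1 M2 N2 I1 J1 I2 J2"
proof -
  note units = abs_zmult_eq_1[of N1 M2] abs_zmult_eq_1[of M2 N1] abs_zmult_eq_1[of M1 N2] abs_zmult_eq_1[of N2 M1]
  consider "M1 = 0" | "N1 = 0" | "M2 = 0" | "N2 = 0" | "M1 \<noteq> 0" "N1 \<noteq> 0" "M2 \<noteq> 0" "N2 \<noteq> 0" by blast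
  then show ?thesis
  proof cases
    case 1
    then have "\<bar>N1\<bar> = 1" "\<bar>M2\<bar> = 1" using det units by (auto simp: mult.commute)
    with 1 show ?thesis using E_table.intros(13-16)[of M1 N1 M2 N2] by (auto simp: abs_if split: if_splits)
  next
    case 2
    then have "\<bar>M1\<bar> = 1" "\<bar>N2\<bar> = 1" using det units by (auto simp: mult.commute)
    \<comment> \<open>The arguments of \<open>of\<close> follow the first occurrences of the
      variables in each rule, hence the permuted lists here and below.\<close>
    with 2 show ?thesis using E_table.intros(17-20)[of M1 N1 N2 M2] by (auto simp: abs_if split: if_splits)
  next
    case 3
    then have "\<bar>M1\<bar> = 1" "\<bar>N2\<bar> = 1" using det units by (auto simp: mult.commute)
    with 3 show ?thesis using E_table.intros(21-24)[of M1 M2 N2 N1] by (auto simp: abs_if split: if_splits)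
  next
    case 4
    then have "\<bar>N1\<bar> = 1" "\<bar>M2\<bar> = 1" using det units by (auto simp: mult.commute)
    with 4 show ?thesis using E_table.intros(25-28)[of N1 M2 N2 M1] by (auto simp: abs_if split: if_splits)
  next
    case 5
    \<comment> \<open>Nonzero integers of opposite signs differ by at least 2.\<close>
    have sgn: "M1 * N2 > 0 \<longleftrightarrow> M2 * N1 > 0"
    proof -
      have "M1 * N2 \<noteq> 0" "M2 * N1 \<noteq> 0" using 5 by auto
      with det show ?thesis by linarith
    qed
    have "\<bar>\<bar>M1\<bar> * \<bar>N2\<bar> - \<bar>M2\<bar> * \<bar>N1\<bar>\<bar> = 1"
    proof (cases "M1 * N2 > 0")
      case True
      with sgn det show ?thesis by (simp flip: abs_mult)
    next
      case False
      moreover have "M1 * N2 \<noteq> 0" "M2 * N1 \<noteq> 0" using 5 by auto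
      ultimately have "M1 * N2 < 0" "M2 * N1 < 0" using sgn by linarith+
      with det show ?thesis by (simp flip: abs_mult)
    qed
    then have "\<bar>M1\<bar> \<le> \<bar>M2\<bar> \<and> \<bar>N1\<bar> \<le> \<bar>N2\<bar> \<or> \<bar>M2\<bar> \<le> \<bar>M1\<bar> \<and> \<bar>N2\<bar> \<le> \<bar>N1\<bar>"
      using 5 by (intro unimodular_comparable) auto
    moreover have "M1 < 0 \<or> M1 > 0" "N1 < 0 \<or> N1 > 0" "M2 < 0 \<or> M2 > 0" "N2 < 0 \<or> N2 > 0"
      using 5 by auto
    ultimately show ?thesis
      using sgn E_table.intros(1-12)[of M1 N1 M2 N2]
      by (elim disjE) (simp_all add: zero_less_mult_iff, blast+)
  qed
qed

section \<open>The coefficients as telescoping sums\<close>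

context torus_bundle
begin

text \<open>\<open>T m n\<close> is \<open>t a\<^sup>m b\<^sup>n = \<theta>(a)\<^sup>m \<theta>(b)\<^sup>n t\<close>.\<close>

definition T :: "int \<Rightarrow> int \<Rightarrow> ((int \<times> int) \<times> int \<Rightarrow>\<^sub>0 int)"
  where "T m n = elt (alpha \<theta> * m + gamma \<theta> * n) (beta \<theta> * m + delta \<theta> * n) 1"

lemma minus_inverse_equations:
  "alpha \<theta> * m\<^sub>1 \<theta> + gamma \<theta> * n\<^sub>1 \<theta> = -1" "beta \<theta> * m\<^sub>1 \<theta> + delta \<theta> * n\<^sub>1 \<theta> = 0"
  "alpha \<theta> * m\<^sub>2 \<theta> + gamma \<theta> * n\<^sub>2 \<theta> = 0" "beta \<theta> * m\<^sub>2 \<theta> + delta \<theta> * n\<^sub>2 \<theta> = -1"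
proof -
  have "\<theta> ** matrix_inv \<theta> = mat 1"
    using invertible_theta unfolding invertible_def matrix_inv_def by (rule someI2_ex) auto
  then have e: "(\<theta> ** matrix_inv \<theta>) $ i $ j = mat 1 $ i $ j" for i j by simp
  show "alpha \<theta> * m\<^sub>1 \<theta> + gamma \<theta> * n\<^sub>1 \<theta> = -1" "beta \<theta> * m\<^sub>1 \<theta> + delta \<theta> * n\<^sub>1 \<theta> = 0"
    "alpha \<theta> * m\<^sub>2 \<theta> + gamma \<theta> * n\<^sub>2 \<theta> = 0" "beta \<theta> * m\<^sub>2 \<theta> + delta \<theta> * n\<^sub>2 \<theta> = -1"
    using e[of 1 1] e[of 2 1] e[of 1 2] e[of 2 2]
    by (auto simp: matrix_matrix_mult_def sum_2 mat_def m\<^sub>1_def m\<^sub>2_def n\<^sub>1_def n\<^sub>2_def)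
qed

text \<open>Multiplicativity of the determinant, written out: the product with the determinant of
  \<open>\<theta>\<close> is the determinant of minus the identity, which is 1 in rank two.\<close>

lemma det_minus_inverse: "\<bar>m\<^sub>1 \<theta> * n\<^sub>2 \<theta> - m\<^sub>2 \<theta> * n\<^sub>1 \<theta>\<bar> = 1"
proof -
  note e = minus_inverse_equations
  have "(alpha \<theta> * delta \<theta> - beta \<theta> * gamma \<theta>) * (m\<^sub>1 \<theta> * n\<^sub>2 \<theta> - m\<^sub>2 \<theta> * n\<^sub>1 \<theta>)
    = (alpha \<theta> * m\<^sub>1 \<theta> + gamma \<theta> * n\<^sub>1 \<theta>) * (beta \<theta> * m\<^sub>2 \<theta> + delta \<theta> * n\<^sub>2 \<theta>)
      - (alpha \<theta> * m\<^sub>2 \<theta> + gamma \<theta> * n\<^sub>2 \<theta>) * (beta \<theta> * m\<^sub>1 \<theta> + delta \<theta> * n\<^sub>1 \<theta>)"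
    by (simp add: algebra_simps)
  also have "\<dots> = 1" by (simp add: e)
  finally show ?thesis by (metis abs_zmult_eq_1 abs_one mult.commute)
qed

lemma T_mul: "T m n \<star> elt p q 0 = T (m + p) (n + q)"
  by (simp add: T_def frag_of_mul act_def algebra_simps)

text \<open>Moving a lattice element from the left of \<open>t\<close> to its right applies the
  inverse of \<open>\<theta>\<close>. The integers \<open>m\<^sub>i\<close>,
  \<open>n\<^sub>i\<close> are the entries of its negative, hence the subtractions.\<close>

lemma mul_T: "elt p q 0 \<star> T m n = T (m - p * m\<^sub>1 \<theta> - q * m\<^sub>2 \<theta>) (n - p * n\<^sub>1 \<theta> - q * n\<^sub>2 \<theta>)"
proof -
  note e = minus_inverse_equations
  have "alpha \<theta> * (m - p * m\<^sub>1 \<theta> - q * m\<^sub>2 \<theta>) + gamma \<theta> * (n - p * n\<^sub>1 \<theta> - q * n\<^sub>2 \<theta>)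
      = alpha \<theta> * m + gamma \<theta> * n - p * (alpha \<theta> * m\<^sub>1 \<theta> + gamma \<theta> * n\<^sub>1 \<theta>) - q * (alpha \<theta> * m\<^sub>2 \<theta> + gamma \<theta> * n\<^sub>2 \<theta>)"
    by (simp add: algebra_simps)
  moreover have "beta \<theta> * (m - p * m\<^sub>1 \<theta> - q * m\<^sub>2 \<theta>) + delta \<theta> * (n - p * n\<^sub>1 \<theta> - q * n\<^sub>2 \<theta>)
      = beta \<theta> * m + delta \<theta> * n - p * (beta \<theta> * m\<^sub>1 \<theta> + delta \<theta> * n\<^sub>1 \<theta>) - q * (beta \<theta> * m\<^sub>2 \<theta> + delta \<theta> * n\<^sub>2 \<theta>)"
    by (simp add: algebra_simps)
  ultimately show ?thesis
    by (simp add: T_def frag_of_mul e add.commute)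
qed

lemma t_eq_T: "elt 0 0 1 = T 0 0"
  by (simp add: T_def)

lemma elt_mul: "elt m n 0 \<star> elt m' n' k = elt (m + m') (n + n') k"
  by (simp add: frag_of_mul)

lemma sum_T_mul_a:
  assumes "p \<le> q + 1"
  shows "(\<Sum>k\<in>{p..q}. T k n) \<star> \<Delta>a = T (q + 1) n - T p n"
  using sum_int_telescope[OF assms, of "\<lambda>k. T k n"]
  by (simp add: sum_mul mul_distribs T_mul sum_subtractf)

lemma sum_T_mul_b:
  assumes "p \<le> q + 1"
  shows "(\<Sum>k\<in>{p..q}. T m k) \<star> \<Delta>b = T m (q + 1) - T m p"
  using sum_int_telescope[OF assms, of "\<lambda>k. T m k"]
  by (simp add: sum_mul mul_distribs T_mul sum_subtractf)

text \<open>The sign cases of the definition merge into one difference of two sums, at most one of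
  them nonempty; multiplied by \<open>\<Delta>a\<close> it telescopes to the same endpoints for
  either sign.\<close>

lemma coeff_A_mul: "coeff_A \<theta> \<star> \<Delta>a = \<Delta>a + T 0 0 - T (- m\<^sub>1 \<theta>) 0"
proof -
  have "coeff_A \<theta> = elt 0 0 0 + (\<Sum>k\<in>{- m\<^sub>1 \<theta>..-1}. T k 0) - (\<Sum>k\<in>{0..- m\<^sub>1 \<theta> - 1}. T k 0)"
    unfolding coeff_A_def
    by (auto simp: T_def mult.commute intro: sum.reindex_bij_witness[of _ uminus uminus])
  moreover have "((\<Sum>k\<in>{- m\<^sub>1 \<theta>..-1}. T k 0) - (\<Sum>k\<in>{0..- m\<^sub>1 \<theta> - 1}. T k 0)) \<star> \<Delta>a = T 0 0 - T (- m\<^sub>1 \<theta>) 0"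
    unfolding mul_distribs(2) by (cases "m\<^sub>1 \<theta> \<ge> 0") (simp_all add: sum_T_mul_a)
  ultimately show ?thesis
    by (simp only: add_diff_eq[symmetric] mul_distribs(1) one_mul)
qed

lemma coeff_C_mul: "coeff_C \<theta> \<star> \<Delta>a = T 0 0 - T (- m\<^sub>2 \<theta>) 0"
proof -
  have "coeff_C \<theta> = (\<Sum>k\<in>{- m\<^sub>2 \<theta>..-1}. T k 0) - (\<Sum>k\<in>{0..- m\<^sub>2 \<theta> - 1}. T k 0)"
    unfolding coeff_C_def
    by (auto simp: T_def mult.commute intro: sum.reindex_bij_witness[of _ uminus uminus])
  moreover have "((\<Sum>k\<in>{- m\<^sub>2 \<theta>..-1}. T k 0) - (\<Sum>k\<in>{0..- m\<^sub>2 \<theta> - 1}. T k 0)) \<star> \<Delta>a = T 0 0 - T (- m\<^sub>2 \<theta>) 0"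
    unfolding mul_distribs(2) by (cases "m\<^sub>2 \<theta> \<ge> 0") (simp_all add: sum_T_mul_a)
  ultimately show ?thesis by simp
qed

lemma sum_shift:
  fixes f :: "int \<Rightarrow> 'a :: comm_monoid_add"
  shows "(\<Sum>k\<in>{0..n - 1}. f (k - n)) = (\<Sum>k\<in>{- n..-1}. f k)"
  by (rule sum.reindex_bij_witness[of _ "\<lambda>k. k + n" "\<lambda>k. k - n"]) auto

lemma sum_reflect:
  fixes f :: "int \<Rightarrow> 'a :: comm_monoid_add"
  shows "(\<Sum>k\<in>{1..- n}. f (- k - n)) = (\<Sum>k\<in>{0..- n - 1}. f k)"
  by (rule sum.reindex_bij_witness[of _ "\<lambda>k. - k - n" "\<lambda>k. - k - n"]) auto

text \<open>The extra factor \<open>a\<close> or \<open>b\<close> on the left is absorbed by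
  \<open>mul_T\<close>; this brings the terms of \<open>coeff_B\<close> and \<open>coeff_D\<close>
  into the form \<open>T\<close>.\<close>

lemma elt_eq_T:
  "elt (1 + alpha \<theta> * m + gamma \<theta> * n) (beta \<theta> * m + delta \<theta> * n) 1 = T (m - m\<^sub>1 \<theta>) (n - n\<^sub>1 \<theta>)"
  "elt (alpha \<theta> * m + gamma \<theta> * n) (1 + beta \<theta> * m + delta \<theta> * n) 1 = T (m - m\<^sub>2 \<theta>) (n - n\<^sub>2 \<theta>)"
  using mul_T[of 1 0 m n] mul_T[of 0 1 m n] by (simp_all add: T_def elt_mul add.assoc)

text \<open>The terms lie on the vertical line with first coordinate
  \<open>- m\<^sub>1 \<theta>\<close>. The endpoint \<open>T (- m\<^sub>1 \<theta>) 0\<close>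
  cancels the one left by \<open>coeff_A_mul\<close>, so the two together form a lattice path to the
  origin.\<close>

lemma coeff_B_mul: "coeff_B \<theta> \<star> \<Delta>b = T (- m\<^sub>1 \<theta>) 0 - T (- m\<^sub>1 \<theta>) (- n\<^sub>1 \<theta>)"
proof -
  have "elt (1 + k * gamma \<theta>) (k * delta \<theta>) 1 = T (- m\<^sub>1 \<theta>) (k - n\<^sub>1 \<theta>)" for k
    using elt_eq_T(1)[of 0 k] by (simp add: mult.commute)
  note T1 = this
  have "elt (1 - k * gamma \<theta>) (- k * delta \<theta>) 1 = T (- m\<^sub>1 \<theta>) (- k - n\<^sub>1 \<theta>)" for k
    using T1[of "- k"] by simp
  note T2 = this
  have "coeff_B \<theta> = (\<Sum>k\<in>{- n\<^sub>1 \<theta>..-1}. T (- m\<^sub>1 \<theta>) k) - (\<Sum>k\<in>{0..- n\<^sub>1 \<theta> - 1}. T (- m\<^sub>1 \<theta>) k)"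
    unfolding coeff_B_def T1 T2 sum_shift sum_reflect by simp
  moreover have "((\<Sum>k\<in>{- n\<^sub>1 \<theta>..-1}. T (- m\<^sub>1 \<theta>) k) - (\<Sum>k\<in>{0..- n\<^sub>1 \<theta> - 1}. T (- m\<^sub>1 \<theta>) k)) \<star> \<Delta>b
      = T (- m\<^sub>1 \<theta>) 0 - T (- m\<^sub>1 \<theta>) (- n\<^sub>1 \<theta>)"
    unfolding mul_distribs(2) by (cases "n\<^sub>1 \<theta> \<ge> 0") (simp_all add: sum_T_mul_b)
  ultimately show ?thesis by simp
qed

lemma coeff_D_mul: "coeff_D \<theta> \<star> \<Delta>b = \<Delta>b + T (- m\<^sub>2 \<theta>) 0 - T (- m\<^sub>2 \<theta>) (- n\<^sub>2 \<theta>)"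
proof -
  have "elt (k * gamma \<theta>) (1 + k * delta \<theta>) 1 = T (- m\<^sub>2 \<theta>) (k - n\<^sub>2 \<theta>)" for k
    using elt_eq_T(2)[of 0 k] by (simp add: mult.commute)
  note T1 = this
  have "elt (- k * gamma \<theta>) (1 - k * delta \<theta>) 1 = T (- m\<^sub>2 \<theta>) (- k - n\<^sub>2 \<theta>)" for k
    using T1[of "- k"] by simp
  note T2 = this
  have "coeff_D \<theta> = elt 0 0 0 + (\<Sum>k\<in>{- n\<^sub>2 \<theta>..-1}. T (- m\<^sub>2 \<theta>) k) - (\<Sum>k\<in>{0..- n\<^sub>2 \<theta> - 1}. T (- m\<^sub>2 \<theta>) k)"
    unfolding coeff_D_def T1 T2 sum_shift sum_reflect by simp
  moreover have "((\<Sum>k\<in>{- n\<^sub>2 \<theta>..-1}. T (- m\<^sub>2 \<theta>) k) - (\<Sum>k\<in>{0..- n\<^sub>2 \<theta> - 1}. T (- m\<^sub>2 \<theta>) k)) \<star> \<Delta>b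
      = T (- m\<^sub>2 \<theta>) 0 - T (- m\<^sub>2 \<theta>) (- n\<^sub>2 \<theta>)"
    unfolding mul_distribs(2) by (cases "n\<^sub>2 \<theta> \<ge> 0") (simp_all add: sum_T_mul_b)
  ultimately show ?thesis
    by (simp only: add_diff_eq[symmetric] mul_distribs(1) one_mul)
qed

text \<open>Telescoping in both directions leaves the four corners with alternating signs.\<close>

lemma rectangle_mul:
  assumes "p \<le> q + 1" "r \<le> s + 1"
  shows "(\<Sum>(m, n)\<in>{p..q} \<times> {r..s}. T m n) \<star> \<Delta>b \<star> \<Delta>a
    = T (q + 1) (s + 1) - T p (s + 1) - T (q + 1) r + T p r"
proof -
  have "(\<Sum>(m, n)\<in>{p..q} \<times> {r..s}. T m n) = (\<Sum>m\<in>{p..q}. \<Sum>n\<in>{r..s}. T m n)"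
    by (simp add: sum.cartesian_product)
  also have "\<dots> \<star> \<Delta>b = (\<Sum>m\<in>{p..q}. T m (s + 1)) - (\<Sum>m\<in>{p..q}. T m r)"
    by (subst sum_mul) (simp add: sum_T_mul_b[OF assms(2)] sum_subtractf)
  also have "\<dots> \<star> \<Delta>a = T (q + 1) (s + 1) - T p (s + 1) - T (q + 1) r + T p r"
    by (simp only: mul_distribs(2) sum_T_mul_a[OF assms(1)]) simp
  finally show ?thesis .
qed

text \<open>The corners of the two rectangles combine to the same six terms in every row; this is
  why overlapping rows define the same \<open>E\<close>.\<close>

lemma E_table_mul:
  assumes "E_table M1 N1 M2 N2 I1 J1 I2 J2"
  shows "((\<Sum>(m, n)\<in>I1 \<times> J1. T m n) - (\<Sum>(m, n)\<in>I2 \<times> J2. T m n)) \<star> \<Delta>b \<star> \<Delta>a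
    = T (- M1) (- N1) - T (- M1) 0 - T (- M2) (- N2) + T (- M2) 0
      + T (- M1 - M2) (- N2) - T (- M1 - M2) (- N1)"
proof -
  \<comment> \<open>When \<open>M1 = 1\<close>, the coordinate \<open>- M1 - M2\<close> turns into
    \<open>- 1 - M2\<close> and has to match the \<open>- M2 - 1\<close> of the table.\<close>
  have [simp]: "- 1 - M2 = - M2 - 1" by simp
  from assms show ?thesis
    unfolding mul_distribs(2)
    \<comment> \<open>\<open>rectangle_mul\<close> serves the rows given by intervals; the rows with
      singletons are expanded directly.\<close>
    by cases (simp_all add: rectangle_mul, simp_all add: mul_distribs T_mul)
qed

text \<open>Some row applies by \<open>E_table_total\<close>, and any two candidates have the same
  product with \<open>\<Delta>b\<close> and \<open>\<Delta>a\<close>, so cancellation makes them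
  equal. The definite description is thus legitimate and inherits the product formula.\<close>

lemma coeff_E_mul:
  "coeff_E \<theta> \<star> \<Delta>b \<star> \<Delta>a = - (\<Delta>b \<star> \<Delta>a)
    + (T (- m\<^sub>1 \<theta>) (- n\<^sub>1 \<theta>) - T (- m\<^sub>1 \<theta>) 0 - T (- m\<^sub>2 \<theta>) (- n\<^sub>2 \<theta>) + T (- m\<^sub>2 \<theta>) 0
      + T (- m\<^sub>1 \<theta> - m\<^sub>2 \<theta>) (- n\<^sub>2 \<theta>) - T (- m\<^sub>1 \<theta> - m\<^sub>2 \<theta>) (- n\<^sub>1 \<theta>))" (is "_ = ?rhs")
proof -
  define Q where "Q e \<longleftrightarrow> (\<exists>I\<^sub>1 J\<^sub>1 I\<^sub>2 J\<^sub>2. E_table (m\<^sub>1 \<theta>) (n\<^sub>1 \<theta>) (m\<^sub>2 \<theta>) (n\<^sub>2 \<theta>) I\<^sub>1 J\<^sub>1 I\<^sub>2 J\<^sub>2 \<and>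
      e = - elt 0 0 0 + (\<Sum>(m, n)\<in>I\<^sub>1 \<times> J\<^sub>1. T m n) - (\<Sum>(m, n)\<in>I\<^sub>2 \<times> J\<^sub>2. T m n))" for e
  have Q: "e \<star> \<Delta>b \<star> \<Delta>a = ?rhs" if Qe: "Q e" for e
  proof -
    obtain I\<^sub>1 J\<^sub>1 I\<^sub>2 J\<^sub>2 where E: "E_table (m\<^sub>1 \<theta>) (n\<^sub>1 \<theta>) (m\<^sub>2 \<theta>) (n\<^sub>2 \<theta>) I\<^sub>1 J\<^sub>1 I\<^sub>2 J\<^sub>2"
      and e: "e = - elt 0 0 0 + (\<Sum>(m, n)\<in>I\<^sub>1 \<times> J\<^sub>1. T m n) - (\<Sum>(m, n)\<in>I\<^sub>2 \<times> J\<^sub>2. T m n)"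
      using Qe unfolding Q_def by blast
    show ?thesis
      unfolding e add_diff_eq[symmetric] mul_distribs(1,3) E_table_mul[OF E] one_mul ..
  qed
  obtain e where "Q e"
    using E_table_total[OF det_minus_inverse] unfolding Q_def by blast
  moreover have "e' = e" if "Q e'" for e'
  proof -
    have "(e' - e) \<star> \<Delta>b \<star> \<Delta>a = 0"
      unfolding mul_distribs(2) Q[OF \<open>Q e\<close>] Q[OF that] by simp
    then have "(e' - e) \<star> \<Delta>b = 0" by (rule mul_Z2_minus_one_cancel) simp
    then have "e' - e = 0" by (rule mul_Z2_minus_one_cancel) simp
    then show ?thesis by simp
  qed
  ultimately have "Q (THE e. Q e)" by (rule theI)
  moreover have "coeff_E \<theta> = (THE e. Q e)"
    unfolding coeff_E_def Q_def T_def ..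
  ultimately show ?thesis using Q by simp
qed

section \<open>Composites of boundary maps vanish\<close>

lemma boundary_1_2:
  "coeff_A \<theta> \<star> \<Delta>a + coeff_B \<theta> \<star> \<Delta>b + \<Delta>a \<star> \<Delta>t = 0"
  "coeff_C \<theta> \<star> \<Delta>a + coeff_D \<theta> \<star> \<Delta>b + \<Delta>b \<star> \<Delta>t = 0"
  "(elt 0 0 0 - elt 0 1 0) \<star> \<Delta>a + \<Delta>a \<star> \<Delta>b = 0"
proof -
  have t: "elt p q 0 \<star> elt 0 0 1 = T (- p * m\<^sub>1 \<theta> - q * m\<^sub>2 \<theta>) (- p * n\<^sub>1 \<theta> - q * n\<^sub>2 \<theta>)" for p q
    using mul_T[of p q 0 0] by (simp add: t_eq_T)
  \<comment> \<open>Here \<open>a\<close> is moved past \<open>t\<close>; the result is the negative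
    of what the telescoped terms with \<open>A\<close> and \<open>B\<close> leave.\<close>
  have "\<Delta>a \<star> \<Delta>t = T (- m\<^sub>1 \<theta>) (- n\<^sub>1 \<theta>) - T 0 0 - \<Delta>a"
    unfolding mul_distribs t one_mul by (simp add: t_eq_T)
  then show "coeff_A \<theta> \<star> \<Delta>a + coeff_B \<theta> \<star> \<Delta>b + \<Delta>a \<star> \<Delta>t = 0"
    unfolding coeff_A_mul coeff_B_mul by simp
  have "\<Delta>b \<star> \<Delta>t = T (- m\<^sub>2 \<theta>) (- n\<^sub>2 \<theta>) - T 0 0 - \<Delta>b"
    unfolding mul_distribs t one_mul by (simp add: t_eq_T)
  then show "coeff_C \<theta> \<star> \<Delta>a + coeff_D \<theta> \<star> \<Delta>b + \<Delta>b \<star> \<Delta>t = 0"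
    unfolding coeff_C_mul coeff_D_mul by simp
  show "(elt 0 0 0 - elt 0 1 0) \<star> \<Delta>a + \<Delta>a \<star> \<Delta>b = 0"
    by (simp add: mul_distribs elt_mul)
qed

lemma mul_one_minus_b: "u \<star> (elt 0 0 0 - elt 0 1 0) = - (u \<star> \<Delta>b)"
  by (simp add: mul_distribs)

text \<open>The first coordinate is checked after multiplication by \<open>\<Delta>a\<close>, where
  the six terms of \<open>coeff_E_mul\<close> appear. The second then follows from the first and
  \<open>boundary_1_2\<close>.\<close>

lemma boundary_2_3:
  "(elt 0 0 0 - elt 0 1 0) \<star> coeff_A \<theta> + \<Delta>a \<star> coeff_C \<theta> + coeff_E \<theta> \<star> (elt 0 0 0 - elt 0 1 0) = 0" (is "?Y1 = 0")
  "(elt 0 0 0 - elt 0 1 0) \<star> coeff_B \<theta> + \<Delta>a \<star> coeff_D \<theta> + coeff_E \<theta> \<star> \<Delta>a = 0" (is "?Y2 = 0")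
  "(elt 0 0 0 - elt 0 1 0) \<star> \<Delta>a + \<Delta>a \<star> \<Delta>b = 0"
proof -
  let ?b = "elt 0 0 0 - elt 0 1 0"
  have neg: "u \<star> ?b = - (u \<star> \<Delta>b)" "?b \<star> u = - (\<Delta>b \<star> u)" for u
    by (simp_all add: mul_distribs)
  show 3: "?b \<star> \<Delta>a + \<Delta>a \<star> \<Delta>b = 0"
    by (rule boundary_1_2)
  have "?Y1 \<star> \<Delta>a = - (\<Delta>b \<star> (coeff_A \<theta> \<star> \<Delta>a)) + \<Delta>a \<star> (coeff_C \<theta> \<star> \<Delta>a) - coeff_E \<theta> \<star> \<Delta>b \<star> \<Delta>a"
    unfolding neg by (simp only: mul_distribs(1,3) mul_assoc diff_conv_add_uminus)
  also have "\<dots> = 0"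
    unfolding coeff_A_mul coeff_C_mul coeff_E_mul
    unfolding mul_distribs elt_mul mul_T one_mul by (simp add: minus_diff_commute)
  finally have "?Y1 \<star> \<Delta>a = 0" .
  then show Y1: "?Y1 = 0"
    by (rule mul_Z2_minus_one_cancel) simp
  \<comment> \<open>Applying the first boundary map to the image of \<open>w\<close> gives a
    combination of the relations in \<open>boundary_1_2\<close>; the contribution of the third
    coordinate has been moved to the right.\<close>
  have "?Y1 \<star> \<Delta>a + ?Y2 \<star> \<Delta>b
      = ?b \<star> (coeff_A \<theta> \<star> \<Delta>a + coeff_B \<theta> \<star> \<Delta>b + \<Delta>a \<star> \<Delta>t)
      + \<Delta>a \<star> (coeff_C \<theta> \<star> \<Delta>a + coeff_D \<theta> \<star> \<Delta>b + \<Delta>b \<star> \<Delta>t)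
      + coeff_E \<theta> \<star> (?b \<star> \<Delta>a + \<Delta>a \<star> \<Delta>b) - (?b \<star> \<Delta>a + \<Delta>a \<star> \<Delta>b) \<star> \<Delta>t"
    by (simp only: mul_distribs(1,4) mul_assoc) simp
  also have "\<dots> = 0"
    unfolding boundary_1_2 by simp
  finally have "?Y2 \<star> \<Delta>b = 0"
    unfolding Y1 by simp
  then show "?Y2 = 0"
    by (rule mul_Z2_minus_one_cancel) simp
qed

section \<open>Exactness in coordinates\<close>

lemma augmentation_mul: "augmentation (u \<star> v) = augmentation u * augmentation v"
  by (simp add: group_ring_def augmentation_mult)

lemma augmentation_boundary_1: "augmentation (p \<star> \<Delta>a + q \<star> \<Delta>b + s \<star> \<Delta>t) = 0"
  by (simp only: augmentation_add augmentation_mul augmentation_diff augmentation_of) simp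

text \<open>Diagram chase at \<open>P\<^sub>1\<close>: the coefficient of \<open>y\<^sub>3\<close>
  lies in the ideal of \<open>\<Delta>a\<close> and \<open>\<Delta>b\<close>, so subtracting a
  combination of the images of \<open>z\<^sub>1\<close> and \<open>z\<^sub>2\<close> removes it.
  What remains is a Koszul cycle, hence a multiple of the image of \<open>z\<^sub>3\<close>.\<close>

lemma exact_coordinates_1:
  assumes "p \<star> \<Delta>a + q \<star> \<Delta>b + s \<star> \<Delta>t = 0"
  shows "\<exists>p' q' s'.
    p = p' \<star> coeff_A \<theta> + q' \<star> coeff_C \<theta> + s' \<star> (elt 0 0 0 - elt 0 1 0) \<and>
    q = p' \<star> coeff_B \<theta> + q' \<star> coeff_D \<theta> + s' \<star> \<Delta>a \<and>
    s = p' \<star> \<Delta>a + q' \<star> \<Delta>b"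
proof -
  obtain p' q' where s: "s = p' \<star> \<Delta>a + q' \<star> \<Delta>b"
    using in_left_ideal_ab_if_mul_t[OF assms] by blast
  let ?p = "p - (p' \<star> coeff_A \<theta> + q' \<star> coeff_C \<theta>)" and ?q = "q - (p' \<star> coeff_B \<theta> + q' \<star> coeff_D \<theta>)"
  have "?p \<star> \<Delta>a + ?q \<star> \<Delta>b = (p \<star> \<Delta>a + q \<star> \<Delta>b + s \<star> \<Delta>t)
      - p' \<star> (coeff_A \<theta> \<star> \<Delta>a + coeff_B \<theta> \<star> \<Delta>b + \<Delta>a \<star> \<Delta>t)
      - q' \<star> (coeff_C \<theta> \<star> \<Delta>a + coeff_D \<theta> \<star> \<Delta>b + \<Delta>b \<star> \<Delta>t)"
    unfolding s by (simp only: mul_distribs(1,4) mul_distribs(2)[of p] mul_distribs(2)[of q] mul_assoc) simp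
  also have "\<dots> = 0"
    unfolding assms boundary_1_2 by simp
  finally obtain s' where "?p = s' \<star> (elt 0 0 0 - elt 0 1 0)" "?q = s' \<star> \<Delta>a"
    using Koszul_exact by blast
  then have "p = p' \<star> coeff_A \<theta> + q' \<star> coeff_C \<theta> + s' \<star> (elt 0 0 0 - elt 0 1 0)"
    "q = p' \<star> coeff_B \<theta> + q' \<star> coeff_D \<theta> + s' \<star> \<Delta>a"
    by (simp_all only: diff_eq_eq ac_simps)
  with s show ?thesis by blast
qed

text \<open>At \<open>P\<^sub>2\<close>, Koszul exactness in the coefficient of
  \<open>y\<^sub>3\<close> yields \<open>r\<close>. Subtracting \<open>r\<close> times the first
  relation of \<open>boundary_2_3\<close> leaves a multiple of \<open>\<Delta>b\<close>, which is
  cancelled.\<close>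

lemma exact_coordinates_2:
  assumes "p \<star> coeff_A \<theta> + q \<star> coeff_C \<theta> + s \<star> (elt 0 0 0 - elt 0 1 0) = 0" "p \<star> \<Delta>a + q \<star> \<Delta>b = 0"
  shows "\<exists>r. p = r \<star> (elt 0 0 0 - elt 0 1 0) \<and> q = r \<star> \<Delta>a \<and> s = r \<star> coeff_E \<theta>"
proof -
  let ?b = "elt 0 0 0 - elt 0 1 0"
  obtain r where r: "p = r \<star> ?b" "q = r \<star> \<Delta>a"
    using Koszul_exact[OF assms(2)] by blast
  have "(s - r \<star> coeff_E \<theta>) \<star> ?b = (p \<star> coeff_A \<theta> + q \<star> coeff_C \<theta> + s \<star> ?b)
      - r \<star> (?b \<star> coeff_A \<theta> + \<Delta>a \<star> coeff_C \<theta> + coeff_E \<theta> \<star> ?b)"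
    unfolding r by (simp only: mul_distribs(4) mul_distribs(2)[of s] mul_assoc) simp
  also have "\<dots> = 0"
    unfolding assms(1) boundary_2_3 by simp
  finally have "(s - r \<star> coeff_E \<theta>) \<star> \<Delta>b = 0"
    by (simp only: mul_one_minus_b neg_equal_0_iff_equal)
  then have "s - r \<star> coeff_E \<theta> = 0"
    by (rule mul_Z2_minus_one_cancel) simp
  with r show ?thesis by auto
qed

lemma exact_coordinates_3:
  assumes "r \<star> (elt 0 0 0 - elt 0 1 0) = 0"
  shows "r = 0"
proof -
  have "r \<star> \<Delta>b = 0" using assms by (simp only: mul_one_minus_b neg_equal_0_iff_equal)
  then show ?thesis by (rule mul_Z2_minus_one_cancel) simp
qed

end

section \<open>The resolution\<close>

theorem theorem2:
  fixes \<theta> :: "int^2^2"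
    and P\<^sub>0 :: "((int \<times> int) \<times> int \<Rightarrow>\<^sub>0 int, 'p0) module"
    and P\<^sub>1 :: "((int \<times> int) \<times> int \<Rightarrow>\<^sub>0 int, 'p1) module"
    and P\<^sub>2 :: "((int \<times> int) \<times> int \<Rightarrow>\<^sub>0 int, 'p2) module"
    and P\<^sub>3 :: "((int \<times> int) \<times> int \<Rightarrow>\<^sub>0 int, 'p3) module"
  assumes "invertible \<theta>"
    and "free_with_basis (torus_bundle_ring \<theta>) P\<^sub>0 {x}"
    and "free_with_basis (torus_bundle_ring \<theta>) P\<^sub>1 {y\<^sub>1, y\<^sub>2, y\<^sub>3}" and "card {y\<^sub>1, y\<^sub>2, y\<^sub>3} = 3"
    and "free_with_basis (torus_bundle_ring \<theta>) P\<^sub>2 {z\<^sub>1, z\<^sub>2, z\<^sub>3}" and "card {z\<^sub>1, z\<^sub>2, z\<^sub>3} = 3"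
    and "free_with_basis (torus_bundle_ring \<theta>) P\<^sub>3 {w}"
  shows "(\<exists>e d\<^sub>1 d\<^sub>2 d\<^sub>3. 
            boundary_maps \<theta> P\<^sub>0 x P\<^sub>1 y\<^sub>1 y\<^sub>2 y\<^sub>3 P\<^sub>2 z\<^sub>1 z\<^sub>2 z\<^sub>3 P\<^sub>3 w e d\<^sub>1 d\<^sub>2 d\<^sub>3) \<and>
         (\<forall>e d\<^sub>1 d\<^sub>2 d\<^sub>3. 
            boundary_maps \<theta> P\<^sub>0 x P\<^sub>1 y\<^sub>1 y\<^sub>2 y\<^sub>3 P\<^sub>2 z\<^sub>1 z\<^sub>2 z\<^sub>3 P\<^sub>3 w e d\<^sub>1 d\<^sub>2 d\<^sub>3 \<longrightarrow>
            free_resolution_length_3 (torus_bundle_ring \<theta>)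
              P\<^sub>3 d\<^sub>3 P\<^sub>2 d\<^sub>2 P\<^sub>1 d\<^sub>1 P\<^sub>0 e trivial_module)"
proof -
  interpret torus_bundle \<theta> using assms(1) by unfold_locales
  let ?R = "torus_bundle_ring \<theta>" and ?Z = "trivial_module :: ((int \<times> int) \<times> int \<Rightarrow>\<^sub>0 int, int) module"
  note F0 = assms(2) and F1 = assms(3,4) and F2 = assms(5,6) and F3 = assms(7)
  have M: "left_module ?R P\<^sub>0" "left_module ?R P\<^sub>1" "left_module ?R P\<^sub>2" "left_module ?R P\<^sub>3"
    using assms by (simp_all add: free_with_basis_def)
  interpret P0: left_module ?R P\<^sub>0 by fact
  interpret P1: left_module ?R P\<^sub>1 by fact
  interpret P2: left_module ?R P\<^sub>2 by fact
  interpret P3: left_module ?R P\<^sub>3 by fact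
  have triv: "left_module ?R trivial_module"
    by (rule left_module_trivial_module[OF group_torus_bundle_group[OF assms(1)]])
  note closed = basis1_closed[OF F0] basis3_closed[OF F1] basis3_closed[OF F2] basis1_closed[OF F3]
  have "\<exists>e\<in>left_module_hom ?R P\<^sub>0 trivial_module. e x = 1"
    by (rule basis1_hom_extension[OF F0 triv]) (simp add: trivial_module_def)
  moreover have "\<exists>d\<^sub>1\<in>left_module_hom ?R P\<^sub>1 P\<^sub>0.
      d\<^sub>1 y\<^sub>1 = \<Delta>a \<odot>\<^bsub>P\<^sub>0\<^esub> x \<and> d\<^sub>1 y\<^sub>2 = \<Delta>b \<odot>\<^bsub>P\<^sub>0\<^esub> x \<and> d\<^sub>1 y\<^sub>3 = \<Delta>t \<odot>\<^bsub>P\<^sub>0\<^esub> x"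
    using closed by (intro basis3_hom_extension[OF F1 M(1)] P0.smult_closed) auto
  moreover have "\<exists>d\<^sub>2\<in>left_module_hom ?R P\<^sub>2 P\<^sub>1.
      d\<^sub>2 z\<^sub>1 = coeff_A \<theta> \<odot>\<^bsub>P\<^sub>1\<^esub> y\<^sub>1 \<oplus>\<^bsub>P\<^sub>1\<^esub> coeff_B \<theta> \<odot>\<^bsub>P\<^sub>1\<^esub> y\<^sub>2 \<oplus>\<^bsub>P\<^sub>1\<^esub> \<Delta>a \<odot>\<^bsub>P\<^sub>1\<^esub> y\<^sub>3 \<and>
      d\<^sub>2 z\<^sub>2 = coeff_C \<theta> \<odot>\<^bsub>P\<^sub>1\<^esub> y\<^sub>1 \<oplus>\<^bsub>P\<^sub>1\<^esub> coeff_D \<theta> \<odot>\<^bsub>P\<^sub>1\<^esub> y\<^sub>2 \<oplus>\<^bsub>P\<^sub>1\<^esub> \<Delta>b \<odot>\<^bsub>P\<^sub>1\<^esub> y\<^sub>3 \<and>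
      d\<^sub>2 z\<^sub>3 = (elt 0 0 0 - elt 0 1 0) \<odot>\<^bsub>P\<^sub>1\<^esub> y\<^sub>1 \<oplus>\<^bsub>P\<^sub>1\<^esub> \<Delta>a \<odot>\<^bsub>P\<^sub>1\<^esub> y\<^sub>2"
    using closed by (intro basis3_hom_extension[OF F2 M(2)] P1.M.a_closed P1.smult_closed) auto
  moreover have "\<exists>d\<^sub>3\<in>left_module_hom ?R P\<^sub>3 P\<^sub>2.
      d\<^sub>3 w = (elt 0 0 0 - elt 0 1 0) \<odot>\<^bsub>P\<^sub>2\<^esub> z\<^sub>1 \<oplus>\<^bsub>P\<^sub>2\<^esub> \<Delta>a \<odot>\<^bsub>P\<^sub>2\<^esub> z\<^sub>2 \<oplus>\<^bsub>P\<^sub>2\<^esub> coeff_E \<theta> \<odot>\<^bsub>P\<^sub>2\<^esub> z\<^sub>3"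
    using closed by (intro basis1_hom_extension[OF F3 M(3)] P2.M.a_closed P2.smult_closed) auto
  ultimately have "\<exists>e d\<^sub>1 d\<^sub>2 d\<^sub>3.
      boundary_maps \<theta> P\<^sub>0 x P\<^sub>1 y\<^sub>1 y\<^sub>2 y\<^sub>3 P\<^sub>2 z\<^sub>1 z\<^sub>2 z\<^sub>3 P\<^sub>3 w e d\<^sub>1 d\<^sub>2 d\<^sub>3"
    unfolding boundary_maps_def by blast
  moreover have "free_resolution_length_3 ?R P\<^sub>3 d\<^sub>3 P\<^sub>2 d\<^sub>2 P\<^sub>1 d\<^sub>1 P\<^sub>0 e trivial_module"
    if maps: "boundary_maps \<theta> P\<^sub>0 x P\<^sub>1 y\<^sub>1 y\<^sub>2 y\<^sub>3 P\<^sub>2 z\<^sub>1 z\<^sub>2 z\<^sub>3 P\<^sub>3 w e d\<^sub>1 d\<^sub>2 d\<^sub>3" for e d\<^sub>1 d\<^sub>2 d\<^sub>3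
  proof -
    have homs: "e \<in> left_module_hom ?R P\<^sub>0 trivial_module" "d\<^sub>1 \<in> left_module_hom ?R P\<^sub>1 P\<^sub>0"
        "d\<^sub>2 \<in> left_module_hom ?R P\<^sub>2 P\<^sub>1" "d\<^sub>3 \<in> left_module_hom ?R P\<^sub>3 P\<^sub>2"
      using maps by (simp_all add: boundary_maps_def)
    \<comment> \<open>Linearity turns the prescribed values on generators into formulas for all
      elements, here and in \<open>d1\<close>, \<open>d2\<close>, \<open>d3\<close>.\<close>
    have e: "e (r \<odot>\<^bsub>P\<^sub>0\<^esub> x) = augmentation r" for r
      using maps closed by (simp add: boundary_maps_def left_module_hom_def trivial_module_def)
    have d1: "d\<^sub>1 (lin3 P\<^sub>1 y\<^sub>1 y\<^sub>2 y\<^sub>3 p q s) = (p \<star> \<Delta>a + q \<star> \<Delta>b + s \<star> \<Delta>t) \<odot>\<^bsub>P\<^sub>0\<^esub> x" for p q s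
    proof -
      have "d\<^sub>1 (lin3 P\<^sub>1 y\<^sub>1 y\<^sub>2 y\<^sub>3 p q s) = lin3 P\<^sub>0 (d\<^sub>1 y\<^sub>1) (d\<^sub>1 y\<^sub>2) (d\<^sub>1 y\<^sub>3) p q s"
        by (rule left_module_hom_lin3[OF F1 homs(2)]) simp_all
      also have "\<dots> = lin3 P\<^sub>0 (\<Delta>a \<odot>\<^bsub>P\<^sub>0\<^esub> x) (\<Delta>b \<odot>\<^bsub>P\<^sub>0\<^esub> x) (\<Delta>t \<odot>\<^bsub>P\<^sub>0\<^esub> x) p q s"
        using maps by (simp add: boundary_maps_def)
      also have "\<dots> = (p \<star> \<Delta>a + q \<star> \<Delta>b + s \<star> \<Delta>t) \<odot>\<^bsub>P\<^sub>0\<^esub> x"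
        using closed by (subst P0.lin3_smult) simp_all
      finally show ?thesis .
    qed
    have d2: "d\<^sub>2 (lin3 P\<^sub>2 z\<^sub>1 z\<^sub>2 z\<^sub>3 p q s) = lin3 P\<^sub>1 y\<^sub>1 y\<^sub>2 y\<^sub>3
        (p \<star> coeff_A \<theta> + q \<star> coeff_C \<theta> + s \<star> (elt 0 0 0 - elt 0 1 0))
        (p \<star> coeff_B \<theta> + q \<star> coeff_D \<theta> + s \<star> \<Delta>a) (p \<star> \<Delta>a + q \<star> \<Delta>b)" for p q s
    proof -
      have "d\<^sub>2 (lin3 P\<^sub>2 z\<^sub>1 z\<^sub>2 z\<^sub>3 p q s) = lin3 P\<^sub>1 (d\<^sub>2 z\<^sub>1) (d\<^sub>2 z\<^sub>2) (d\<^sub>2 z\<^sub>3) p q s"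
        by (rule left_module_hom_lin3[OF F2 homs(3)]) simp_all
      \<comment> \<open>The prescribed value has two terms; a zero multiple of
        \<open>y\<^sub>3\<close> is added so that \<open>lin3_lin3\<close> applies.\<close>
      also have "d\<^sub>2 z\<^sub>3 = lin3 P\<^sub>1 y\<^sub>1 y\<^sub>2 y\<^sub>3 (elt 0 0 0 - elt 0 1 0) \<Delta>a 0"
        using maps closed P1.smult_zero_left[of y\<^sub>3] by (simp add: boundary_maps_def P1.smult_closed)
      also have "d\<^sub>2 z\<^sub>1 = lin3 P\<^sub>1 y\<^sub>1 y\<^sub>2 y\<^sub>3 (coeff_A \<theta>) (coeff_B \<theta>) \<Delta>a"
        using maps by (simp add: boundary_maps_def)
      also have "d\<^sub>2 z\<^sub>2 = lin3 P\<^sub>1 y\<^sub>1 y\<^sub>2 y\<^sub>3 (coeff_C \<theta>) (coeff_D \<theta>) \<Delta>b"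
        using maps by (simp add: boundary_maps_def)
      finally show ?thesis
        using closed by (subst (asm) P1.lin3_lin3) simp_all
    qed
    have d3: "d\<^sub>3 (r \<odot>\<^bsub>P\<^sub>3\<^esub> w) = lin3 P\<^sub>2 z\<^sub>1 z\<^sub>2 z\<^sub>3
        (r \<star> (elt 0 0 0 - elt 0 1 0)) (r \<star> \<Delta>a) (r \<star> coeff_E \<theta>)" for r
    proof -
      have "d\<^sub>3 (r \<odot>\<^bsub>P\<^sub>3\<^esub> w) = r \<odot>\<^bsub>P\<^sub>2\<^esub> d\<^sub>3 w"
        using homs(4) closed by (simp add: left_module_hom_def)
      also have "\<dots> = r \<odot>\<^bsub>P\<^sub>2\<^esub> lin3 P\<^sub>2 z\<^sub>1 z\<^sub>2 z\<^sub>3 (elt 0 0 0 - elt 0 1 0) \<Delta>a (coeff_E \<theta>)"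
        using maps by (simp add: boundary_maps_def)
      finally show ?thesis
        using closed by (subst (asm) P2.smult_lin3) simp_all
    qed
    have zero1: "lin3 P\<^sub>1 y\<^sub>1 y\<^sub>2 y\<^sub>3 p q s = \<zero>\<^bsub>P\<^sub>1\<^esub> \<longleftrightarrow> p = 0 \<and> q = 0 \<and> s = 0" for p q s
      using P1.lin3_zero[of y\<^sub>1 y\<^sub>2 y\<^sub>3] closed basis3_independent[OF F1, of p q s 0 0 0] by auto
    have zero2: "lin3 P\<^sub>2 z\<^sub>1 z\<^sub>2 z\<^sub>3 p q s = \<zero>\<^bsub>P\<^sub>2\<^esub> \<longleftrightarrow> p = 0 \<and> q = 0 \<and> s = 0" for p q s
      using P2.lin3_zero[of z\<^sub>1 z\<^sub>2 z\<^sub>3] closed basis3_independent[OF F2, of p q s 0 0 0] by auto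
    have zero0: "r \<odot>\<^bsub>P\<^sub>0\<^esub> x = \<zero>\<^bsub>P\<^sub>0\<^esub> \<longleftrightarrow> r = 0" for r
      using P0.smult_zero_left[of x] closed basis1_independent[OF F0, of r 0] by auto
    have zero3: "\<zero>\<^bsub>P\<^sub>3\<^esub> = 0 \<odot>\<^bsub>P\<^sub>3\<^esub> w"
      using P3.smult_zero_left[of w] closed by simp
    have carrier0: "carrier P\<^sub>0 = range (\<lambda>r. r \<odot>\<^bsub>P\<^sub>0\<^esub> x)"
      using basis1_span[OF F0] closed by (auto intro: P0.smult_closed)
    have carrier3: "carrier P\<^sub>3 = range (\<lambda>r. r \<odot>\<^bsub>P\<^sub>3\<^esub> w)"
      using basis1_span[OF F3] closed by (auto intro: P3.smult_closed)
    have carrier1: "carrier P\<^sub>1 = {lin3 P\<^sub>1 y\<^sub>1 y\<^sub>2 y\<^sub>3 p q s | p q s. True}"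
      unfolding basis3_carrier[OF F1] by simp
    have carrier2: "carrier P\<^sub>2 = {lin3 P\<^sub>2 z\<^sub>1 z\<^sub>2 z\<^sub>3 p q s | p q s. True}"
      unfolding basis3_carrier[OF F2] by simp
    have ker3: "a_kernel P\<^sub>3 P\<^sub>2 d\<^sub>3 = {\<zero>\<^bsub>P\<^sub>3\<^esub>}"
    proof (intro equalityI subsetI)
      fix v assume "v \<in> a_kernel P\<^sub>3 P\<^sub>2 d\<^sub>3"
      then obtain r where v: "v = r \<odot>\<^bsub>P\<^sub>3\<^esub> w" "d\<^sub>3 v = \<zero>\<^bsub>P\<^sub>2\<^esub>"
        unfolding a_kernel_def' carrier3 by blast
      then have "r = 0"
        unfolding v(1) d3 zero2 using exact_coordinates_3 by blast
      then show "v \<in> {\<zero>\<^bsub>P\<^sub>3\<^esub>}" by (simp add: v zero3)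
    next
      fix v assume "v \<in> {\<zero>\<^bsub>P\<^sub>3\<^esub>}"
      then have "v = 0 \<odot>\<^bsub>P\<^sub>3\<^esub> w" by (simp add: zero3)
      moreover have "d\<^sub>3 (0 \<odot>\<^bsub>P\<^sub>3\<^esub> w) = \<zero>\<^bsub>P\<^sub>2\<^esub>"
        unfolding d3 zero2 by simp
      ultimately show "v \<in> a_kernel P\<^sub>3 P\<^sub>2 d\<^sub>3"
        unfolding a_kernel_def' carrier3 by blast
    qed
    have ex2: "d\<^sub>3 ` carrier P\<^sub>3 = a_kernel P\<^sub>2 P\<^sub>1 d\<^sub>2"
    proof (intro equalityI subsetI)
      fix v assume "v \<in> d\<^sub>3 ` carrier P\<^sub>3"
      then obtain r where "v = d\<^sub>3 (r \<odot>\<^bsub>P\<^sub>3\<^esub> w)" unfolding carrier3 by blast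
      moreover have "r \<star> (elt 0 0 0 - elt 0 1 0) \<star> coeff_A \<theta> + r \<star> \<Delta>a \<star> coeff_C \<theta>
            + r \<star> coeff_E \<theta> \<star> (elt 0 0 0 - elt 0 1 0) = 0"
          "r \<star> (elt 0 0 0 - elt 0 1 0) \<star> coeff_B \<theta> + r \<star> \<Delta>a \<star> coeff_D \<theta> + r \<star> coeff_E \<theta> \<star> \<Delta>a = 0"
          "r \<star> (elt 0 0 0 - elt 0 1 0) \<star> \<Delta>a + r \<star> \<Delta>a \<star> \<Delta>b = 0"
        unfolding mul_assoc mul_distribs(4)[symmetric] boundary_2_3 mul_zero by (rule refl)+
      then have "d\<^sub>2 (d\<^sub>3 (r \<odot>\<^bsub>P\<^sub>3\<^esub> w)) = \<zero>\<^bsub>P\<^sub>1\<^esub>"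
        unfolding d3 d2 zero1 by blast
      ultimately show "v \<in> a_kernel P\<^sub>2 P\<^sub>1 d\<^sub>2"
        unfolding a_kernel_def' carrier2 d3 by blast
    next
      fix v assume "v \<in> a_kernel P\<^sub>2 P\<^sub>1 d\<^sub>2"
      then obtain p q s where v: "v = lin3 P\<^sub>2 z\<^sub>1 z\<^sub>2 z\<^sub>3 p q s" "d\<^sub>2 v = \<zero>\<^bsub>P\<^sub>1\<^esub>"
        unfolding a_kernel_def' carrier2 by blast
      then obtain r where "p = r \<star> (elt 0 0 0 - elt 0 1 0)" "q = r \<star> \<Delta>a" "s = r \<star> coeff_E \<theta>"
        unfolding v(1) d2 zero1 using exact_coordinates_2 by blast
      then have "v = d\<^sub>3 (r \<odot>\<^bsub>P\<^sub>3\<^esub> w)"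
        by (simp only: v d3)
      then show "v \<in> d\<^sub>3 ` carrier P\<^sub>3" unfolding carrier3 by blast
    qed
    have ex1: "d\<^sub>2 ` carrier P\<^sub>2 = a_kernel P\<^sub>1 P\<^sub>0 d\<^sub>1"
    proof (intro equalityI subsetI)
      fix v assume "v \<in> d\<^sub>2 ` carrier P\<^sub>2"
      then obtain p q s where "v = d\<^sub>2 (lin3 P\<^sub>2 z\<^sub>1 z\<^sub>2 z\<^sub>3 p q s)" unfolding carrier2 by blast
      \<comment> \<open>The terms are regrouped by \<open>p\<close>, \<open>q\<close>,
        \<open>s\<close>; each bracket is a relation from \<open>boundary_1_2\<close>.\<close>
      moreover have "(p \<star> coeff_A \<theta> + q \<star> coeff_C \<theta> + s \<star> (elt 0 0 0 - elt 0 1 0)) \<star> \<Delta>a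
          + (p \<star> coeff_B \<theta> + q \<star> coeff_D \<theta> + s \<star> \<Delta>a) \<star> \<Delta>b + (p \<star> \<Delta>a + q \<star> \<Delta>b) \<star> \<Delta>t
        = p \<star> (coeff_A \<theta> \<star> \<Delta>a + coeff_B \<theta> \<star> \<Delta>b + \<Delta>a \<star> \<Delta>t)
          + q \<star> (coeff_C \<theta> \<star> \<Delta>a + coeff_D \<theta> \<star> \<Delta>b + \<Delta>b \<star> \<Delta>t)
          + s \<star> ((elt 0 0 0 - elt 0 1 0) \<star> \<Delta>a + \<Delta>a \<star> \<Delta>b)"
        by (simp only: mul_distribs(1,4) mul_assoc ac_simps)
      then have "d\<^sub>1 (d\<^sub>2 (lin3 P\<^sub>2 z\<^sub>1 z\<^sub>2 z\<^sub>3 p q s)) = \<zero>\<^bsub>P\<^sub>0\<^esub>"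
        unfolding d2 d1 zero0 boundary_1_2 by simp
      ultimately show "v \<in> a_kernel P\<^sub>1 P\<^sub>0 d\<^sub>1"
        unfolding a_kernel_def' carrier1 d2 by blast
    next
      fix v assume "v \<in> a_kernel P\<^sub>1 P\<^sub>0 d\<^sub>1"
      then obtain p q s where v: "v = lin3 P\<^sub>1 y\<^sub>1 y\<^sub>2 y\<^sub>3 p q s" "d\<^sub>1 v = \<zero>\<^bsub>P\<^sub>0\<^esub>"
        unfolding a_kernel_def' carrier1 by blast
      then have "p \<star> \<Delta>a + q \<star> \<Delta>b + s \<star> \<Delta>t = 0"
        by (simp only: d1 zero0)
      from exact_coordinates_1[OF this] obtain p' q' s' where "v = d\<^sub>2 (lin3 P\<^sub>2 z\<^sub>1 z\<^sub>2 z\<^sub>3 p' q' s')"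
        unfolding v(1) d2 by blast
      then show "v \<in> d\<^sub>2 ` carrier P\<^sub>2" unfolding carrier2 by blast
    qed
    have zero_trivial: "\<zero>\<^bsub>?Z\<^esub> = 0"
      by (simp add: trivial_module_def)
    have ex0: "d\<^sub>1 ` carrier P\<^sub>1 = a_kernel P\<^sub>0 ?Z e"
    proof (intro equalityI subsetI)
      fix v assume "v \<in> d\<^sub>1 ` carrier P\<^sub>1"
      then obtain p q s where "v = d\<^sub>1 (lin3 P\<^sub>1 y\<^sub>1 y\<^sub>2 y\<^sub>3 p q s)" unfolding carrier1 by blast
      moreover have "e (d\<^sub>1 (lin3 P\<^sub>1 y\<^sub>1 y\<^sub>2 y\<^sub>3 p q s)) = 0"
        unfolding d1 e by (rule augmentation_boundary_1)
      ultimately show "v \<in> a_kernel P\<^sub>0 ?Z e"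
        unfolding a_kernel_def' carrier0 d1 zero_trivial by blast
    next
      fix v assume "v \<in> a_kernel P\<^sub>0 ?Z e"
      then obtain r where v: "v = r \<odot>\<^bsub>P\<^sub>0\<^esub> x" "augmentation r = 0"
        unfolding a_kernel_def' carrier0 zero_trivial using e by auto
      from augmentation_ideal[OF v(2)] obtain p q s where "v = d\<^sub>1 (lin3 P\<^sub>1 y\<^sub>1 y\<^sub>2 y\<^sub>3 p q s)"
        unfolding v(1) d1 by blast
      then show "v \<in> d\<^sub>1 ` carrier P\<^sub>1" unfolding carrier1 by blast
    qed
    have surj: "e ` carrier P\<^sub>0 = carrier ?Z"
    proof -
      \<comment> \<open>An integer \<open>z\<close> is the augmentation of \<open>z\<close> times
        the identity of \<open>G\<close>.\<close>
      have "z = e (frag_cmul z (elt 0 0 0) \<odot>\<^bsub>P\<^sub>0\<^esub> x)" for z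
        by (simp add: e augmentation_lookup frag_extend_cmul)
      then show ?thesis
        by (auto simp: carrier0 trivial_module_def)
    qed
    show ?thesis
      unfolding free_resolution_length_3_def exact_at_def free_left_module_def
      using triv assms homs ker3 ex2 ex1 ex0 surj by blast
  qed
  ultimately show ?thesis by blast
qed

end
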